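(* Let $\mathcal P$ be a finitely generated (symmetric) operad over a field $\Bbbk$. Then the Gelfand–Kirillov dimension of $\mathcal P$ is not strictly between $1$ and $2$; that is, there is no finitely generated symmetric operad $\mathcal P$ with $1<\operatorname{GKdim}(\mathcal P)<2$.
   Context: $\Bbbk$ is a field. "Operad" means a symmetric operad $\mathcal P$ in $\Bbbk$-vector spaces, given by right $\Bbbk\mathbb S_n$-modules $\mathcal P(n)$ ($n\ge 0$), an identity $1_{\mathcal P}\in\mathcal P(1)$ and partial compositions $\circ_i:\mathcal P(m)\otimes\mathcal P(n)\to\mathcal P(m+n-1)$, $1\le i\le m$, satisfying the usual unit, associativity and equivariance axioms. All operads are assumed reduced ($\mathcal P(0)=0$) and locally finite ($\dim_\Bbbk\mathcal P(n)<\infty$ for all $n$). $\mathcal P$ is finitely generated if it is generated by finitely many elements as a symmetric operad. The Gelfand–Kirillov dimension is $\operatorname{GKdim}(\mathcal P)=\limsup_{n\to\infty}\log_n\bigl(\sum_{i=0}^n\dim\mathcal P(i)\bigr)$. *)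

theory Defs
  imports
    Complex_Main
    "HOL-Library.Extended_Real"
    "HOL-Library.Liminf_Limsup"
    "HOL-Combinatorics.Permutations"
begin

(* The permutation of {1..m+n-1} that applies a permutation s of {1..n} to the block
   {i..i+n-1} and fixes everything else. *)
definition inner_perm :: "nat \<Rightarrow> nat \<Rightarrow> (nat \<Rightarrow> nat) \<Rightarrow> nat \<Rightarrow> nat" where
  "inner_perm n i s p = (if i \<le> p \<and> p < i + n then (i - 1) + s (p - (i - 1)) else p)"

(* The permutation of {1..m+n-1} induced by a permutation t of {1..m} when its i-th letter is
   replaced by a block of n letters: the block {i..i+n-1} is carried, in order, to
   {t i..t i+n-1}, and the remaining letters are permuted by t after renumbering. *)
definition outer_perm :: "nat \<Rightarrow> nat \<Rightarrow> (nat \<Rightarrow> nat) \<Rightarrow> nat \<Rightarrow> nat" where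
  "outer_perm n i t p =
     (let shift = (\<lambda>q. if q < t i then q else q + n - 1)
      in if p < i then shift (t p)
         else if p < i + n then t i + (p - i)
         else shift (t (p + 1 - n)))"

(* The components P n are subspaces of one ambient vector space. This is no restriction, since
   any family of vector spaces embeds in its direct sum; the components need not be independent
   or disjoint, so every operation carries the arities of its arguments:
     act n x s         is the right action of s on x in P n,
     comp m n i x y    is the partial composition of x in P m and y in P n at the i-th input.
   The equivariance axioms are those obtained from (x^s)(v_1,...,v_n) = x(v_{s^-1(1)},...,v_{s^-1(n)}),
   for which (x^s)^t = x^(s o t). *)
locale symmetric_operad = vector_space scale
  for scale :: "'k::field \<Rightarrow> 'v::ab_group_add \<Rightarrow> 'v"  (infixr \<open>*s\<close> 75) +
  fixes P :: "nat \<Rightarrow> 'v set"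
    and act :: "nat \<Rightarrow> 'v \<Rightarrow> (nat \<Rightarrow> nat) \<Rightarrow> 'v"
    and one :: 'v
    and comp :: "nat \<Rightarrow> nat \<Rightarrow> nat \<Rightarrow> 'v \<Rightarrow> 'v \<Rightarrow> 'v"
  assumes subspace_P: "subspace (P n)"
    and act_closed: "\<lbrakk>x \<in> P n; s permutes {1..n}\<rbrakk> \<Longrightarrow> act n x s \<in> P n"
    and act_add: "\<lbrakk>x \<in> P n; y \<in> P n; s permutes {1..n}\<rbrakk>
          \<Longrightarrow> act n (x + y) s = act n x s + act n y s"
    and act_scale: "\<lbrakk>x \<in> P n; s permutes {1..n}\<rbrakk> \<Longrightarrow> act n (c *s x) s = c *s act n x s"
    and act_id: "x \<in> P n \<Longrightarrow> act n x id = x"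
    and act_act: "\<lbrakk>x \<in> P n; s permutes {1..n}; t permutes {1..n}\<rbrakk>
          \<Longrightarrow> act n (act n x s) t = act n x (s \<circ> t)"
    and comp_closed: "\<lbrakk>x \<in> P m; y \<in> P n; i \<in> {1..m}\<rbrakk> \<Longrightarrow> comp m n i x y \<in> P (m + n - 1)"
    and comp_add_left: "\<lbrakk>x \<in> P m; x' \<in> P m; y \<in> P n; i \<in> {1..m}\<rbrakk>
          \<Longrightarrow> comp m n i (x + x') y = comp m n i x y + comp m n i x' y"
    and comp_scale_left: "\<lbrakk>x \<in> P m; y \<in> P n; i \<in> {1..m}\<rbrakk>
          \<Longrightarrow> comp m n i (c *s x) y = c *s comp m n i x y"
    and comp_add_right: "\<lbrakk>x \<in> P m; y \<in> P n; y' \<in> P n; i \<in> {1..m}\<rbrakk>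
          \<Longrightarrow> comp m n i x (y + y') = comp m n i x y + comp m n i x y'"
    and comp_scale_right: "\<lbrakk>x \<in> P m; y \<in> P n; i \<in> {1..m}\<rbrakk>
          \<Longrightarrow> comp m n i x (c *s y) = c *s comp m n i x y"
    and one_closed: "one \<in> P 1"
    and comp_one_left: "y \<in> P n \<Longrightarrow> comp 1 n 1 one y = y"
    and comp_one_right: "\<lbrakk>x \<in> P m; i \<in> {1..m}\<rbrakk> \<Longrightarrow> comp m 1 i x one = x"
    and comp_assoc_sequential:
      "\<lbrakk>x \<in> P l; y \<in> P m; z \<in> P n; i \<in> {1..l}; j \<in> {1..m}\<rbrakk>
        \<Longrightarrow> comp (l + m - 1) n (i - 1 + j) (comp l m i x y) z
            = comp l (m + n - 1) i x (comp m n j y z)"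
    and comp_assoc_parallel:
      "\<lbrakk>x \<in> P l; y \<in> P m; z \<in> P n; 1 \<le> i; i < k; k \<le> l\<rbrakk>
        \<Longrightarrow> comp (l + m - 1) n (k - 1 + m) (comp l m i x y) z
            = comp (l + n - 1) m i (comp l n k x z) y"
    and comp_act_right:
      "\<lbrakk>x \<in> P m; y \<in> P n; i \<in> {1..m}; s permutes {1..n}\<rbrakk>
        \<Longrightarrow> comp m n i x (act n y s) = act (m + n - 1) (comp m n i x y) (inner_perm n i s)"
    and comp_act_left:
      "\<lbrakk>x \<in> P m; y \<in> P n; i \<in> {1..m}; t permutes {1..m}\<rbrakk>
        \<Longrightarrow> comp m n i (act m x t) y = act (m + n - 1) (comp m n (t i) x y) (outer_perm n i t)"
begin

definition reduced :: bool where
  "reduced \<longleftrightarrow> P 0 = {0}"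

definition locally_finite :: bool where
  "locally_finite \<longleftrightarrow> (\<forall>n. \<exists>B. finite B \<and> span B = P n)"

(* generated G n x: x lies in the arity n component of the suboperad generated by G, where
   (n, x) in G stands for a generator x of arity n. *)
inductive generated :: "(nat \<times> 'v) set \<Rightarrow> nat \<Rightarrow> 'v \<Rightarrow> bool" for G where
  gen: "(n, x) \<in> G \<Longrightarrow> generated G n x"
| one: "generated G 1 one"
| zero: "generated G n 0"
| add: "\<lbrakk>generated G n x; generated G n y\<rbrakk> \<Longrightarrow> generated G n (x + y)"
| scale: "generated G n x \<Longrightarrow> generated G n (c *s x)"
| act: "\<lbrakk>generated G n x; s permutes {1..n}\<rbrakk> \<Longrightarrow> generated G n (act n x s)"
| comp: "\<lbrakk>generated G m x; generated G n y; i \<in> {1..m}\<rbrakk>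
    \<Longrightarrow> generated G (m + n - 1) (comp m n i x y)"

definition finitely_generated :: bool where
  "finitely_generated \<longleftrightarrow>
     (\<exists>G. finite G \<and> (\<forall>(n, x) \<in> G. x \<in> P n) \<and> (\<forall>n. P n = {x. generated G n x}))"

(* Meaningful for locally finite operads only, since dim is 0 on infinite-dimensional spaces.
   As ln 0 = 0, the zero operad has dimension 0 here rather than minus infinity. *)
definition GKdim :: ereal where
  "GKdim = limsup (\<lambda>n. ereal (log (real n) (real (\<Sum>i\<le>n. dim (P i)))))"

end

end

theory Submission
  imports Defs "HOL-Library.Multiset_Order" "HOL-Real_Asymp.Real_Asymp"
begin

text \<open>
  Suppose that the growth of the operad is subquadratic. Then the components of small dimension
  relative to their arity are so frequent that any number of them occur in a row. A representation
  of the symmetric group on n letters whose dimension is small compared to n is trivial on the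
  alternating group (\<open>small_module_transpositions_agree\<close>); here an arity n is called tame if
  the alternating group acts trivially on P n, that is, if all transpositions act in the same way.

  Let the generators have arity at most r. Above arity r every component is spanned by
  permuted compositions of an element with an operation of arity between 2 and r on one of
  its inputs (\<open>generated_leaf_sum\<close>). Grafting two such operations onto disjoint inputs of one
  element produces an operation that is symmetric off either of the two blocks, because
  smaller arities are tame. These two symmetries generate the whole alternating group.
  Hence a long enough run of tame arities makes every later arity tame (\<open>tame_propagates\<close>).

  In tame arities it does not matter, up to the action of the symmetric group, at which input one
  composes, and by the parallel associativity axiom compositions with different operations commute.
  So in large arities the operad looks like a finitely generated graded module over a
  commutative polynomial ring, whose variables are the operations of arity between 2 and r.
  As for monomial ideals, a monomial order yields standard monomials, which are
  closed under division, span the module, and are at most as many in each degree as the dimension.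
  A set of monomials closed under division either contains all monomials in some two of the
  variables, so that the growth is at least quadratic, or has boundedly many elements in each
  degree (\<open>order_ideal_dichotomy\<close>). Therefore subquadratic growth forces bounded
  dimensions (\<open>bounded_dim_if_subquadratic\<close>), and then the Gelfand-Kirillov dimension
  is at most 1.
\<close>

section \<open>Small representations of symmetric groups\<close>

context vector_space
begin

lemma subspace_dim_mono:
  assumes "U \<subseteq> V" "V \<subseteq> span B" "finite B"
  shows "dim U \<le> dim V"
proof -
  obtain b where b: "b \<subseteq> V" "independent b" "V \<subseteq> span b" "card b = dim V"
    using basis_exists[of V] by blast
  have "finite b"
    using independent_span_bound[OF assms(3) b(2)] b(1) assms(2) by auto
  then show ?thesis
    using dim_le_card[of U b] assms(1) b by auto
qed

lemma subspace_dim_strict_mono: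
  assumes "subspace U" "subspace V" "U \<subset> V" "V \<subseteq> span B" "finite B"
  shows "dim U < dim V"
proof -
  obtain b where b: "b \<subseteq> U" "independent b" "U \<subseteq> span b" "card b = dim U"
    using basis_exists[of U] by blast
  obtain x where x: "x \<in> V" "x \<notin> U"
    using assms(3) by blast
  have sb: "span b = U"
    using b(1,3) assms(1) span_minimal by blast
  have ind: "independent (insert x b)"
    using b(2) x(2) sb by (intro independent_insertI) auto
  have fin: "finite (insert x b)"
    using independent_span_bound[OF assms(5) ind] b(1) assms(3,4) x(1) by auto
  have "card (insert x b) = dim (insert x b)"
    using dim_eq_card_independent[OF ind] by simp
  also have "\<dots> \<le> dim V"
    using assms x b(1) by (intro subspace_dim_mono[of _ V B]) auto
  finally show ?thesis
    using b(4) fin x(2) b(1) by (auto simp: card_insert_if split: if_splits)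
qed

end

text \<open>Permutations compose as functions, so the law \<open>ac_ac\<close> describes a right action.\<close>

locale permutation_module = vector_space scale
  for scale :: "'k::field \<Rightarrow> 'v::ab_group_add \<Rightarrow> 'v"  (infixr \<open>*s\<close> 75) +
  fixes X :: "'x set" and M :: "'v set" and ac :: "'v \<Rightarrow> ('x \<Rightarrow> 'x) \<Rightarrow> 'v"
  assumes subspace_M: "subspace M"
    and ac_closed: "\<lbrakk>v \<in> M; s permutes X\<rbrakk> \<Longrightarrow> ac v s \<in> M"
    and ac_add: "\<lbrakk>v \<in> M; w \<in> M; s permutes X\<rbrakk> \<Longrightarrow> ac (v + w) s = ac v s + ac w s"
    and ac_scale: "\<lbrakk>v \<in> M; s permutes X\<rbrakk> \<Longrightarrow> ac (c *s v) s = c *s ac v s"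
    and ac_id: "v \<in> M \<Longrightarrow> ac v id = v"
    and ac_ac: "\<lbrakk>v \<in> M; s permutes X; t permutes X\<rbrakk> \<Longrightarrow> ac (ac v s) t = ac v (s \<circ> t)"
begin

definition stable :: "'x set \<Rightarrow> 'v set \<Rightarrow> bool" where
  "stable Y U \<longleftrightarrow> (\<forall>v\<in>U. \<forall>s. s permutes Y \<longrightarrow> ac v s \<in> U)"

lemma stableD: "stable Y U \<Longrightarrow> v \<in> U \<Longrightarrow> s permutes Y \<Longrightarrow> ac v s \<in> U"
  by (auto simp: stable_def)

lemma ac_diff:
  assumes "v \<in> M" "w \<in> M" "s permutes X"
  shows "ac (v - w) s = ac v s - ac w s"
proof -
  have "ac ((v - w) + w) s = ac (v - w) s + ac w s"
    using assms by (intro ac_add subspace_diff subspace_M) auto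
  then show ?thesis by (simp add: algebra_simps)
qed

text \<open>Quotients are avoided throughout: a statement about V/W is a statement about elements of V
  modulo W. Conjugating \<open>(a b)\<close> by \<open>(b c)\<close> gives \<open>(a c)\<close>, so a transposition that acts on V/W as the
  scalar e forces all others to act as e, too.\<close>

lemma transposition_scalar_move:
  assumes sub: "subspace W" "W \<subseteq> V" "V \<subseteq> M" and st: "stable Y V" "stable Y W" and YX: "Y \<subseteq> X"
    and abc: "a \<in> Y" "b \<in> Y" "c \<in> Y" "a \<noteq> b" "a \<noteq> c"
    and eq: "\<And>v. v \<in> V \<Longrightarrow> ac v (transpose a b) - e *s v \<in> W"
    and v: "v \<in> V"
  shows "ac v (transpose a c) - e *s v \<in> W"
proof (cases "b = c")
  case True
  then show ?thesis using eq[OF v] by simp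
next
  case False
  have pX: "transpose x y permutes Y" "transpose x y permutes X" if "x \<in> Y" "y \<in> Y" for x y
    using permutes_swap_id[OF that] permutes_subset[OF _ YX] by auto
  let ?t = "transpose b c" and ?s = "transpose a b"
  define u where "u = ac v ?t"
  have u: "u \<in> V" unfolding u_def using stableD[OF st(1) v] pX abc by auto
  have uM: "u \<in> M" "v \<in> M" using u v sub by auto
  have "ac (ac u ?s - e *s u) ?t \<in> W"
    using stableD[OF st(2) eq[OF u]] pX abc by auto
  also have "ac (ac u ?s - e *s u) ?t = ac (ac u ?s) ?t - e *s ac u ?t"
    using uM pX abc by (subst ac_diff) (auto intro!: ac_closed ac_scale subspace_scale subspace_M)
  also have "ac u ?t = v"
    unfolding u_def using uM pX abc by (subst ac_ac) (auto simp: ac_id)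
  also have "ac (ac u ?s) ?t = ac v (?t \<circ> ?s \<circ> ?t)"
    unfolding u_def using uM pX abc
    by (simp add: ac_ac permutes_compose ac_closed o_assoc)
  also have "?t \<circ> ?s \<circ> ?t = transpose a c"
    using False abc by (auto simp: fun_eq_iff transpose_def)
  finally show ?thesis .
qed

lemma transposition_scalar_everywhere:
  assumes sub: "subspace W" "W \<subseteq> V" "V \<subseteq> M" and st: "stable Y V" "stable Y W" and YX: "Y \<subseteq> X"
    and pq: "p \<in> Y" "q \<in> Y" "p \<noteq> q" 
    and eq: "\<And>v. v \<in> V \<Longrightarrow> ac v (transpose p q) - e *s v \<in> W"
    and ab: "a \<in> Y" "b \<in> Y" "a \<noteq> b" and v: "v \<in> V"
  shows "ac v (transpose a b) - e *s v \<in> W"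
proof -
  note move = transposition_scalar_move[OF sub st YX]
  show ?thesis
  proof (cases "p = b")
    case True
    have "ac v (transpose p a) - e *s v \<in> W"
      using move[of p q a e v] pq ab eq v True by blast
    then show ?thesis using True by (simp add: transpose_commute)
  next
    case False
    have "ac w (transpose p b) - e *s w \<in> W" if "w \<in> V" for w
      using move[of p q b e w] pq ab eq that False by blast
    then have "ac w (transpose b p) - e *s w \<in> W" if "w \<in> V" for w
      using that by (simp add: transpose_commute)
    then have "ac v (transpose b a) - e *s v \<in> W"
      using move[of b p a e v] pq ab v False by auto
    then show ?thesis by (simp add: transpose_commute)
  qed
qed

text \<open>Suppose that even permutations act trivially on V/V' and on V'/W. Then their actions on V/W
  differ from the identity by maps whose pairwise products vanish, hence these actions commute with
  one another. But the 3-cycle \<open>(a b c)\<close> is inverted by the even permutation \<open>(a b)(d e)\<close>, so it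
  acts as its own inverse; having order 3, it acts trivially. This argument works in every
  characteristic.\<close>

lemma unipotent_three_cycle:
  assumes sub: "subspace W" "subspace V'" "W \<subseteq> V'" "V' \<subseteq> V" "V \<subseteq> M"
    and st: "stable Y V" "stable Y V'" "stable Y W" and YX: "Y \<subseteq> X"
    and dist: "distinct [a, b, c, d, e]" "{a, b, c, d, e} \<subseteq> Y"
    and eqV: "\<And>v s t. v \<in> V \<Longrightarrow> s \<in> T \<Longrightarrow> t \<in> T \<Longrightarrow> ac v s - ac v t \<in> V'"
    and eqV': "\<And>v s t. v \<in> V' \<Longrightarrow> s \<in> T \<Longrightarrow> t \<in> T \<Longrightarrow> ac v s - ac v t \<in> W"
    and T: "T = {transpose x y |x y. x \<in> Y \<and> y \<in> Y \<and> x \<noteq> y}"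
    and v: "v \<in> V"
  shows "ac v (transpose a b) - ac v (transpose b c) \<in> W"
proof -
  have pY: "s permutes Y" if "s \<in> T" for s
    using that unfolding T by (auto intro: permutes_swap_id)
  have pX: "s permutes X" if "s permutes Y" for s
    using permutes_subset[OF that YX] .
  have inv2: "s \<circ> s = id" if "s \<in> T" for s
    using that unfolding T by auto
  define E where "E = {s \<circ> t |s t. s \<in> T \<and> t \<in> T}"
  have EY: "s permutes Y" if "s \<in> E" for s
    using that pY unfolding E_def by (auto intro: permutes_compose)
  have EX: "s permutes X" if "s \<in> E" for s
    using pX[OF EY[OF that]] .
  have trivV: "ac v s - v \<in> V'" if vs: "v \<in> V" "s \<in> E" for v s
  proof -
    obtain s1 s2 where s: "s = s1 \<circ> s2" "s1 \<in> T" "s2 \<in> T"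
      using vs(2) unfolding E_def by blast
    have "ac (ac v s1 - ac v s2) s2 \<in> V'"
      using stableD[OF st(2) eqV] vs s pY by auto
    moreover have "ac (ac v s1 - ac v s2) s2 = ac v s - v"
      using vs sub s pX pY by (subst ac_diff) (auto simp: ac_ac ac_id inv2 intro!: ac_closed)
    ultimately show ?thesis by simp
  qed
  have trivV': "ac v s - v \<in> W" if vs: "v \<in> V'" "s \<in> E" for v s
  proof -
    obtain s1 s2 where s: "s = s1 \<circ> s2" "s1 \<in> T" "s2 \<in> T"
      using vs(2) unfolding E_def by blast
    have "ac (ac v s1 - ac v s2) s2 \<in> W"
      using stableD[OF st(3) eqV'] vs s pY by auto
    moreover have "ac (ac v s1 - ac v s2) s2 = ac v s - v"
      using vs sub s pX pY by (subst ac_diff) (auto simp: ac_ac ac_id inv2 intro!: ac_closed)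
    ultimately show ?thesis by simp
  qed
  have comm: "ac v (s \<circ> t) - ac v (t \<circ> s) \<in> W" if "v \<in> V" "s \<in> E" "t \<in> E" for v s t
  proof -
    have M: "v \<in> M" "ac v s \<in> M" "ac v t \<in> M"
      using that sub EX by (auto intro!: ac_closed)
    have 1: "ac (ac v s - v) t - (ac v s - v) \<in> W" "ac (ac v t - v) s - (ac v t - v) \<in> W"
      using that trivV trivV' by auto
    have "(ac (ac v s - v) t - (ac v s - v)) - (ac (ac v t - v) s - (ac v t - v)) \<in> W"
      by (rule subspace_diff[OF sub(1) 1])
    also have "(ac (ac v s - v) t - (ac v s - v)) - (ac (ac v t - v) s - (ac v t - v))
        = ac v (s \<circ> t) - ac v (t \<circ> s)"
      using M that EX by (simp add: ac_diff ac_ac)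
    finally show ?thesis .
  qed
  define s where "s = transpose a b \<circ> transpose b c"
  define t where "t = transpose a b \<circ> transpose d e"
  have sE: "s \<in> E" "t \<in> E"
    unfolding s_def t_def E_def T using dist by auto
  define s' where "s' = transpose b c \<circ> transpose a b"
  have s'E: "s' \<in> E"
    unfolding s'_def E_def T using dist by auto
  have id1: "t \<circ> s = s' \<circ> t" "s \<circ> s = s'" "s \<circ> s' = id" "t \<circ> t = id"
    using dist unfolding s_def t_def s'_def by (auto simp: fun_eq_iff transpose_def)
  \<comment> \<open>The double transposition t inverts the 3-cycle s, whose inverse is s'.\<close>
  have ss': "ac v s - ac v s' \<in> W" if "v \<in> V" for v
  proof -
    have "ac (ac v (s \<circ> t) - ac v (t \<circ> s)) t \<in> W"
      using stableD[OF st(3) comm] that sE EY by auto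
    also have "ac (ac v (s \<circ> t) - ac v (t \<circ> s)) t = ac v (s \<circ> t \<circ> t) - ac v (t \<circ> s \<circ> t)"
      using that sub sE EX by (subst ac_diff) (auto simp: ac_ac permutes_compose subset_iff intro!: ac_closed)
    also have "s \<circ> t \<circ> t = s"
      using id1 by (simp add: o_assoc[symmetric])
    also have "t \<circ> s \<circ> t = s'"
      using id1 by (simp add: o_assoc[symmetric])
    finally show ?thesis .
  qed
  have "ac v s' - v \<in> W"
  proof -
    have u: "ac v s \<in> V" using stableD[OF st(1) v] EY sE by auto
    have "ac (ac v s) s - ac (ac v s) s' \<in> W" using ss'[OF u] .
    then show ?thesis
      using v sub sE s'E EX id1 by (auto simp: ac_ac ac_id)
  qed
  then have "(ac v s - ac v s') + (ac v s' - v) \<in> W"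
    using ss'[OF v] by (intro subspace_add[OF sub(1)])
  then have "ac v s - v \<in> W" by simp
  moreover have "transpose b c permutes Y"
    using dist by (auto intro!: permutes_swap_id)
  ultimately have "ac (ac v s - v) (transpose b c) \<in> W"
    using stableD[OF st(3)] by auto
  also have "ac (ac v s - v) (transpose b c) = ac v (s \<circ> transpose b c) - ac v (transpose b c)"
    using v sub sE EX pX[OF \<open>transpose b c permutes Y\<close>]
    by (subst ac_diff) (auto simp: ac_ac intro!: ac_closed)
  also have "s \<circ> transpose b c = transpose a b"
    unfolding s_def by (simp add: o_assoc[symmetric])
  finally show ?thesis .
qed

text \<open>
  Induction on the dimension k of V/W. Let g be a transposition and let V'/W be the subspace of
  vectors of V/W that it fixes. If this is everything, then all transpositions act trivially. If it
  is zero, then g acts as -1, because \<open>u + g u\<close> is fixed, and so do all transpositions. Otherwise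
  V'/W and V/V' have smaller dimension, and both are stable under the permutations of the
  letters not moved by g. By induction the even ones among these act trivially on both, and
  the commutator argument applies. Each step uses up two letters, and the commutator
  argument needs five.
\<close>

theorem small_module_transpositions_agree:
  assumes "subspace W" "subspace V" "W \<subseteq> V" "V \<subseteq> M" "V \<subseteq> span B" "finite B"
    and "stable Y V" "stable Y W" and "Y \<subseteq> X" "finite Y"
    and "dim V \<le> dim W + k" "2 * k + 5 \<le> card Y"
    and "a \<in> Y" "b \<in> Y" "c \<in> Y" "d \<in> Y" "a \<noteq> b" "c \<noteq> d" and "v \<in> V"
  shows "ac v (transpose a b) - ac v (transpose c d) \<in> W"
  using assms
proof (induction k arbitrary: V W Y a b c d v)
  case 0
  have "W = V"
    using subspace_dim_strict_mono[of W V B] 0(1-6,11) by force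
  moreover have "transpose a b permutes Y" "transpose c d permutes Y"
    using 0 by (auto intro!: permutes_swap_id)
  ultimately show ?case
    using 0(2,19) stableD[OF 0(7) 0(19)] by (auto intro!: subspace_diff)
next
  case (Suc k V W Y)
  note sub = Suc.prems(1-6) and st = Suc.prems(7,8) and Y = Suc.prems(9,10)
  have pY: "transpose x y permutes Y" "transpose x y permutes X" if "x \<in> Y" "y \<in> Y" for x y
    using permutes_swap_id[OF that] permutes_subset[OF _ Y(1)] by auto
  have key: "ac v (transpose a b) - ac v (transpose b c) \<in> W"
    if abc: "a \<in> Y" "b \<in> Y" "c \<in> Y" "a \<noteq> b" "a \<noteq> c" "b \<noteq> c" and v: "v \<in> V" for a b c v
  proof -
    have "card (Y - {a, b, c}) \<ge> 4"
      using abc Suc.prems(12) Y by (subst card_Diff_subset) auto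
    then obtain Z where Z: "Z \<subseteq> Y - {a, b, c}" "card Z = 4" "finite Z"
      by (metis obtain_subset_with_card_n)
    then obtain zs where zs: "set zs = Z" "distinct zs"
      using finite_distinct_list by blast
    then have "length zs = 4"
      using Z distinct_card by fastforce
    then obtain p q d e where "zs = [p, q, d, e]"
      by (auto simp: length_Suc_conv numeral_eq_Suc)
    then have pqde: "distinct [p, q, d, e]" "{p, q, d, e} \<subseteq> Y - {a, b, c}"
      using zs Z(1) by auto
    define g where "g = transpose p q"
    \<comment> \<open>The preimage in V of the vectors of V/W fixed by g.\<close>
    define V' where "V' = {v \<in> V. ac v g - v \<in> W}"
    have gp: "g permutes Y" "g permutes X" and gg: "g \<circ> g = id"
      unfolding g_def using pY pqde by auto
    have subV': "subspace V'"
      unfolding V'_def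
    proof (rule subspaceI, safe)
      show "0 \<in> V" using sub subspace_0 by auto
      have "ac (0 *s 0) g = 0 *s ac 0 g"
        using subspace_0[OF subspace_M] gp by (intro ac_scale) auto
      then show "ac 0 g - 0 \<in> W" using sub subspace_0 by auto
    next
      fix x y assume xy: "x \<in> V" "y \<in> V" "ac x g - x \<in> W" "ac y g - y \<in> W"
      then show "x + y \<in> V" using sub subspace_add by auto
      have "(ac x g - x) + (ac y g - y) \<in> W"
        using xy sub subspace_add by blast
      then show "ac (x + y) g - (x + y) \<in> W"
        using xy sub gp by (subst ac_add) (auto simp: algebra_simps)
    next
      fix x r assume x: "x \<in> V" "ac x g - x \<in> W"
      then show "r *s x \<in> V" using sub subspace_scale by auto
      have "r *s (ac x g - x) \<in> W"
        using x sub subspace_scale by blast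
      then show "ac (r *s x) g - r *s x \<in> W"
        using x sub gp by (subst ac_scale) (auto simp: scale_right_diff_distrib)
    qed
    have WV': "W \<subseteq> V'" "V' \<subseteq> V"
      unfolding V'_def using sub stableD[OF st(2) _ gp(1)] by (auto intro: subspace_diff)
    note everywhere = transposition_scalar_everywhere[OF sub(1,3,4) st Y(1)]
    have pq: "p \<in> Y" "q \<in> Y" "p \<noteq> q" using pqde by auto
    consider "V' = V" | "V' = W" | "W \<subset> V'" "V' \<subset> V"
      using WV' by auto
    then show ?thesis
    proof cases
      case 1
      have *: "ac u (transpose p q) - 1 *s u \<in> W" if "u \<in> V" for u
        using that 1 unfolding V'_def g_def by auto
      have "(ac v (transpose a b) - 1 *s v) - (ac v (transpose b c) - 1 *s v) \<in> W"
        by (rule subspace_diff[OF sub(1) everywhere[OF pq *] everywhere[OF pq *]]) (use abc v in auto)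
      then show ?thesis by simp
    next
      case 2
      \<comment> \<open>The vector g u + u is fixed by g, so g acts as the scalar -1 on V/W.\<close>
      have *: "ac u (transpose p q) - (-1) *s u \<in> W" if u: "u \<in> V" for u
      proof -
        have uM: "u \<in> M" "ac u g \<in> M" "ac u g \<in> V"
          using u sub gp stableD[OF st(1) u] by (auto intro!: ac_closed)
        have "ac (ac u g + u) g = u + ac u g"
          using uM gp by (simp add: ac_add ac_ac gg ac_id)
        then have "ac u g + u \<in> V'"
          unfolding V'_def using uM u sub(1,2) by (auto intro: subspace_add subspace_0 simp: algebra_simps)
        then show ?thesis using 2 g_def by simp
      qed
      have "(ac v (transpose a b) - (-1) *s v) - (ac v (transpose b c) - (-1) *s v) \<in> W"
        by (rule subspace_diff[OF sub(1) everywhere[OF pq *] everywhere[OF pq *]]) (use abc v in auto)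
      then show ?thesis by simp
    next
      case 3
      have "dim W < dim V'" "dim V' < dim V"
        using 3 sub subV' by (auto intro!: subspace_dim_strict_mono[where B = B])
      then have dims: "dim V \<le> dim V' + k" "dim V' \<le> dim W + k"
        using Suc.prems(11) by auto
      define Y' where "Y' = Y - {p, q}"
      have Y': "Y' \<subseteq> Y" "Y' \<subseteq> X" "finite Y'" and card: "2 * k + 5 \<le> card Y'"
        unfolding Y'_def using Y pq Suc.prems(12) by (auto simp: card_Diff_subset)
      have pY': "s permutes Y" if "s permutes Y'" for s
        using permutes_subset[OF that Y'(1)] .
      have st': "stable Y' V" "stable Y' W"
        using st pY' unfolding stable_def by auto
      have stV': "stable Y' V'"
        unfolding stable_def
      proof (intro ballI allI impI)
        fix x s assume x: "x \<in> V'" and s: "s permutes Y'"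
        have xM: "x \<in> M" "x \<in> V" "ac x g - x \<in> W" "ac x g \<in> M"
          using x WV' sub gp unfolding V'_def by (auto intro!: ac_closed)
        have sX: "s permutes X" "s permutes Y"
          using permutes_subset[OF s] Y' by auto
        have fixpq: "s p = p" "s q = q"
          using s unfolding Y'_def by (auto intro: permutes_not_in)
        have "s x = p \<longleftrightarrow> x = p" "s x = q \<longleftrightarrow> x = q" for x
          using fixpq permutes_inj[OF s] by (metis injD)+
        then have comm: "s \<circ> g = g \<circ> s"
          unfolding g_def using fixpq by (auto simp: fun_eq_iff transpose_def)
        have "ac (ac x g - x) s \<in> W"
          using stableD[OF st(2) xM(3) sX(2)] .
        also have "ac (ac x g - x) s = ac (ac x s) g - ac x s"
          using xM sX gp by (simp add: ac_diff ac_ac comm)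
        finally show "ac x s \<in> V'"
          unfolding V'_def using stableD[OF st(1) xM(2) sX(2)] by auto
      qed
      have V'M: "V' \<subseteq> M" using WV'(2) sub(4) by (rule order.trans)
      have "V' \<subseteq> span B" using WV' sub by auto
      note IH1 = Suc.IH[OF subV' sub(2) WV'(2) sub(4-6) st'(1) stV' Y'(2,3) dims(1) card]
      note IH2 = Suc.IH[OF sub(1) subV' WV'(1) V'M \<open>V' \<subseteq> span B\<close> sub(6) stV' st'(2) Y'(2,3) dims(2) card]
      show ?thesis
      proof (rule unipotent_three_cycle[OF sub(1) subV' WV' sub(4) st'(1) stV' st'(2) Y'(2)])
        show "distinct [a, b, c, d, e]" "{a, b, c, d, e} \<subseteq> Y'"
          using abc pqde unfolding Y'_def by auto
      qed (use IH1 IH2 v in auto)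
    qed
  qed
  have key2: "ac v (transpose x y) - ac v (transpose y z) \<in> W"
    if "x \<in> Y" "y \<in> Y" "z \<in> Y" "x \<noteq> y" "y \<noteq> z" for x y z
  proof (cases "x = z")
    case True
    then show ?thesis using sub(1) by (simp add: transpose_commute subspace_0)
  next
    case False
    then show ?thesis using key that Suc.prems(19) by auto
  qed
  show ?case
  proof (cases "b = c")
    case True
    then show ?thesis using key2 Suc.prems by auto
  next
    case False
    have "(ac v (transpose a b) - ac v (transpose b c)) + (ac v (transpose b c) - ac v (transpose c d)) \<in> W"
      using key2 Suc.prems False by (intro subspace_add sub(1)) auto
    then show ?thesis by simp
  qed
qed

end

section \<open>Grafting operations of bounded arity\<close>

lemma inner_perm_permutes:
  assumes s: "s permutes {1..n}" and i: "i \<in> {1..m}"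
  shows "inner_perm n i s permutes {1..m + n - 1}"
proof (rule inj_imp_permutes)
  have sinj: "s x = s y \<longleftrightarrow> x = y" for x y
    using permutes_inj[OF s] by (auto dest: injD)
  have rng: "1 \<le> s q \<and> s q \<le> n" if "1 \<le> q" "q \<le> n" for q
    using permutes_in_image[OF s, of q] that by auto
  show "inj_on (inner_perm n i s) {1..m + n - 1}"
  proof (rule inj_onI)
    fix p q assume "p \<in> {1..m + n - 1}" "q \<in> {1..m + n - 1}"
      and eq: "inner_perm n i s p = inner_perm n i s q"
    have block: "i \<le> inner_perm n i s p \<and> inner_perm n i s p < i + n \<longleftrightarrow> i \<le> p \<and> p < i + n" for p
    proof (cases "i \<le> p \<and> p < i + n")
      case True
      then have "1 \<le> s (p - (i - 1)) \<and> s (p - (i - 1)) \<le> n"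
        using i by (intro rng) auto
      then show ?thesis using True i by (simp add: inner_perm_def) linarith
    qed (auto simp: inner_perm_def)
    show "p = q"
    proof (cases "i \<le> p \<and> p < i + n")
      case True
      then have "i \<le> q \<and> q < i + n"
        using block[of p] block[of q] eq by simp
      then have "s (p - (i - 1)) = s (q - (i - 1))"
        using True eq by (simp add: inner_perm_def)
      then have "p - (i - 1) = q - (i - 1)" by (simp only: sinj)
      then show ?thesis using True \<open>i \<le> q \<and> q < i + n\<close> i by auto
    next
      case False
      then have "\<not> (i \<le> q \<and> q < i + n)"
        using block[of p] block[of q] eq by simp
      then show ?thesis using False eq unfolding inner_perm_def by (simp only: if_False)
    qed
  qed
  show "inner_perm n i s p \<in> {1..m + n - 1}" if "p \<in> {1..m + n - 1}" for p
  proof (cases "i \<le> p \<and> p < i + n")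
    case True
    then have "1 \<le> s (p - (i - 1)) \<and> s (p - (i - 1)) \<le> n"
      using i by (intro rng) auto
    then show ?thesis using True i by (simp add: inner_perm_def) linarith
  qed (use that in \<open>auto simp: inner_perm_def\<close>)
  show "inner_perm n i s p = p" if "p \<notin> {1..m + n - 1}" for p
    using that i by (auto simp: inner_perm_def)
qed auto

lemma outer_perm_permutes:
  assumes t: "t permutes {1..m}" and i: "i \<in> {1..m}" and n: "1 \<le> n"
  shows "outer_perm n i t permutes {1..m + n - 1}"
proof (rule inj_imp_permutes)
  have tinj: "t x = t y \<longleftrightarrow> x = y" for x y
    using permutes_inj[OF t] by (auto dest: injD)
  have rng: "1 \<le> t q \<and> t q \<le> m" if "1 \<le> q" "q \<le> m" for q
    using permutes_in_image[OF t, of q] that by auto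
  have out: "t q = q" if "m < q" for q
    using permutes_not_in[OF t, of q] that by auto
  have out0: "t 0 = 0"
    using permutes_not_in[OF t, of 0] by auto
  have ti: "1 \<le> t i" "t i \<le> m" using rng i by auto
  show "inj_on (outer_perm n i t) {1..m + n - 1}"
  proof (rule inj_onI)
    fix p q assume "p \<in> {1..m + n - 1}" "q \<in> {1..m + n - 1}"
      and eq: "outer_perm n i t p = outer_perm n i t q"
    \<comment> \<open>Collapsing the block to a single letter turns the permutation back into t.\<close>
    define c where "c j p = (if p < j then p else if p < j + n then j else p + 1 - n)" for j p
    have collapse: "c (t i) (outer_perm n i t p) = t (c i p)" for p
    proof -
      consider "p < i" | "i \<le> p" "p < i + n" | "i + n \<le> p" by linarith
      then show ?thesis
      proof cases
        case 1
        then have "t p \<noteq> t i" using tinj by auto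
        then show ?thesis using 1 n by (auto simp: outer_perm_def c_def)
      next
        case 2
        then show ?thesis by (auto simp: outer_perm_def c_def)
      next
        case 3
        then have "t (p + 1 - n) \<noteq> t i" using tinj n by auto
        then show ?thesis using 3 n by (auto simp: outer_perm_def c_def)
      qed
    qed
    have "t (c i p) = t (c i q)"
      using collapse[of p] collapse[of q] eq by simp
    then have c: "c i p = c i q" by (simp only: tinj)
    show "p = q"
    proof (cases "c i p = i")
      case True
      then have "i \<le> p" "p < i + n" "i \<le> q" "q < i + n"
        using c by (auto simp: c_def split: if_splits)
      then show ?thesis using eq by (simp add: outer_perm_def)
    next
      case False
      then show ?thesis using c n by (auto simp: c_def split: if_splits)
    qed
  qed
  show "outer_perm n i t p \<in> {1..m + n - 1}" if "p \<in> {1..m + n - 1}" for p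
  proof -
    consider "p < i" | "i \<le> p" "p < i + n" | "i + n \<le> p" by linarith
    then show ?thesis
    proof cases
      case 1
      then have "1 \<le> t p \<and> t p \<le> m" using that i by (intro rng) auto
      then show ?thesis using 1 n by (auto simp: outer_perm_def)
    next
      case 2
      then show ?thesis using ti by (auto simp: outer_perm_def)
    next
      case 3
      then have "1 \<le> t (p + 1 - n) \<and> t (p + 1 - n) \<le> m" using that i n by (intro rng) auto
      then show ?thesis using 3 n by (auto simp: outer_perm_def)
    qed
  qed
  show "outer_perm n i t p = p" if "p \<notin> {1..m + n - 1}" for p
  proof (cases "p = 0")
    case False
    then have "t (p + 1 - n) = p + 1 - n" "p \<ge> i + n" "t i < p + 1 - n"
      using that i n ti by (auto intro!: out)
    then show ?thesis using n by (auto simp: outer_perm_def)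
  qed (use i ti out0 in \<open>auto simp: outer_perm_def\<close>)
qed auto

text \<open>A transposition of two letters other than the expanded letter i expands to a transposition
  of two letters outside the block; this is how symmetries of an operation pass to a composition.\<close>

lemma outer_perm_transpose:
  assumes "1 \<le> n" "a \<noteq> i" "b \<noteq> i"
  shows "outer_perm n i (transpose a b)
    = transpose (if a < i then a else a + n - 1) (if b < i then b else b + n - 1)"
proof
  fix p
  have ti: "transpose a b i = i"
    using assms by simp
  consider "p < i" | "i \<le> p" "p < i + n" | "i + n \<le> p" by linarith
  then show "outer_perm n i (transpose a b) p
    = transpose (if a < i then a else a + n - 1) (if b < i then b else b + n - 1) p"
  proof cases
    case 1
    then have "outer_perm n i (transpose a b) p
        = (if transpose a b p < i then transpose a b p else transpose a b p + n - 1)"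
      by (simp add: outer_perm_def ti)
    then show ?thesis using 1 assms by (auto simp: transpose_def)
  next
    case 2
    then have "outer_perm n i (transpose a b) p = p"
      by (simp add: outer_perm_def ti)
    then show ?thesis using 2 assms by (auto simp: transpose_def)
  next
    case 3
    define q where "q = p + 1 - n"
    then have q: "p = q + n - 1" "i < q" using 3 assms by auto
    then have "outer_perm n i (transpose a b) p
        = (if transpose a b q < i then transpose a b q else transpose a b q + n - 1)"
      using assms by (simp add: outer_perm_def ti)
    then show ?thesis using q assms by (auto simp: transpose_def)
  qed
qed

context symmetric_operad
begin

lemma permutation_module_P: "permutation_module (*s) {1..n} (P n) (act n)"
  by unfold_locales (auto simp: subspace_P act_closed act_add act_scale act_id act_act)

lemma act_zero: "s permutes {1..n} \<Longrightarrow> act n 0 s = 0"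
  using act_scale[of 0 n s 0] subspace_0[OF subspace_P] by simp

lemma comp_zero_left: "\<lbrakk>y \<in> P n; i \<in> {1..m}\<rbrakk> \<Longrightarrow> comp m n i 0 y = 0"
  using comp_scale_left[of 0 m y n i 0] subspace_0[OF subspace_P] by simp

lemma comp_zero_right: "\<lbrakk>x \<in> P m; i \<in> {1..m}\<rbrakk> \<Longrightarrow> comp m n i x 0 = 0"
  using comp_scale_right[of x m 0 n i 0] subspace_0[OF subspace_P] by simp

text \<open>Equivariance moves a composition to any other input, at the price of permuting the left
  factor and the result.\<close>

lemma comp_change_input:
  assumes "x \<in> P m" "y \<in> P n" "1 \<le> n" "i \<in> {1..m}" "j \<in> {1..m}"
  shows "comp m n i x y
    = act (m + n - 1) (comp m n j (act m x (transpose i j)) y) (outer_perm n i (transpose i j))"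
proof -
  have t: "transpose i j permutes {1..m}"
    using assms by (intro permutes_swap_id)
  have "comp m n i (act m (act m x (transpose i j)) (transpose i j)) y
    = act (m + n - 1) (comp m n (transpose i j i) (act m x (transpose i j)) y) (outer_perm n i (transpose i j))"
    using assms t by (intro comp_act_left act_closed)
  then show ?thesis
    using assms t by (simp add: act_act act_id)
qed

text \<open>Sums of operations of arity n that have, as an outermost vertex, an operation of arity between
  2 and r all of whose inputs are inputs of the whole.\<close>

inductive leaf_sum :: "nat \<Rightarrow> nat \<Rightarrow> 'v \<Rightarrow> bool" for r where
  base: "\<lbrakk>x \<in> P m; g \<in> P k; i \<in> {1..m}; 2 \<le> k; k \<le> r; n = m + k - 1; s permutes {1..n}\<rbrakk>
    \<Longrightarrow> leaf_sum r n (act n (comp m k i x g) s)"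
| zero: "leaf_sum r n 0"
| add: "\<lbrakk>leaf_sum r n x; leaf_sum r n y\<rbrakk> \<Longrightarrow> leaf_sum r n (x + y)"

lemma leaf_sum_in_P: "leaf_sum r n x \<Longrightarrow> x \<in> P n"
proof (induction rule: leaf_sum.induct)
  case (base x m g k i n s)
  then show ?case using comp_closed[of x m g k i] by (auto intro: act_closed)
qed (auto intro: subspace_0 subspace_add subspace_P)

lemma leaf_sum_scale: "leaf_sum r n x \<Longrightarrow> leaf_sum r n (c *s x)"
proof (induction rule: leaf_sum.induct)
  case (base x m g k i n s)
  have "c *s act n (comp m k i x g) s = act n (comp m k i (c *s x) g) s"
    using base comp_closed[of x m g k i] by (simp add: act_scale comp_scale_left)
  then show ?case
    using leaf_sum.base[OF subspace_scale[OF subspace_P base(1)] base(2-7)] by simp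
qed (auto simp: scale_right_distrib intro: leaf_sum.intros)

lemma leaf_sum_act: "leaf_sum r n x \<Longrightarrow> t permutes {1..n} \<Longrightarrow> leaf_sum r n (act n x t)"
proof (induction rule: leaf_sum.induct)
  case (base x m g k i n s)
  have "act n (act n (comp m k i x g) s) t = act n (comp m k i x g) (s \<circ> t)"
    using base comp_closed[of x m g k i] by (simp add: act_act)
  then show ?case
    using leaf_sum.base[OF base(1-6) permutes_compose[OF base(8,7)]] by simp
next
  case (add n x y)
  then show ?case
    using leaf_sum_in_P by (auto simp: act_add intro: leaf_sum.add)
qed (auto simp: act_zero intro: leaf_sum.intros)

lemma leaf_sum_comp_right:
  "leaf_sum r n y \<Longrightarrow> x \<in> P m \<Longrightarrow> i \<in> {1..m} \<Longrightarrow> leaf_sum r (m + n - 1) (comp m n i x y)"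
proof (induction rule: leaf_sum.induct)
  case (base x' m' g k j n s)
  have N: "m + n - 1 = (m + m' - 1) + k - 1"
    using base by auto
  have "comp m n i x (act n (comp m' k j x' g) s)
      = act (m + n - 1) (comp m n i x (comp m' k j x' g)) (inner_perm n i s)"
    using base comp_closed[of x' m' g k j] comp_act_right[of x m "comp m' k j x' g" n i s] by simp
  moreover have "comp m n i x (comp m' k j x' g) = comp (m + m' - 1) k (i - 1 + j) (comp m m' i x x') g"
    using base comp_assoc_sequential[of x m x' m' g k i j] by simp
  moreover have "i - 1 + j \<in> {1..m + m' - 1}"
    using base by auto
  ultimately show ?case
    using leaf_sum.base[of "comp m m' i x x'" "m + m' - 1" g k "i - 1 + j" r "m + n - 1" "inner_perm n i s"]
      base comp_closed[of x m x' m' i] inner_perm_permutes[of s n i m] N by auto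
next
  case (add n y y')
  then show ?case
    using leaf_sum_in_P by (auto simp: comp_add_right intro: leaf_sum.add)
qed (auto simp: comp_zero_right intro: leaf_sum.intros)

lemma leaf_sum_comp_unary:
  "leaf_sum r n x \<Longrightarrow> y \<in> P 1 \<Longrightarrow> i \<in> {1..n} \<Longrightarrow> leaf_sum r n (comp n 1 i x y)"
proof (induction rule: leaf_sum.induct)
  case (base x m g k j n s)
  define p where "p = s i"
  have p: "p \<in> {1..n}"
    unfolding p_def using permutes_in_image[OF base(7), of i] base(9) by simp
  have w: "comp m k j x g \<in> P n"
    using base comp_closed by auto
  have perm: "outer_perm 1 i s permutes {1..n}"
    using outer_perm_permutes[of s n i 1] base by auto
  have eq: "comp n 1 i (act n (comp m k j x g) s) y
      = act n (comp n 1 p (comp m k j x g) y) (outer_perm 1 i s)"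
    using base w comp_act_left[of "comp m k j x g" n y 1 i s] by (simp add: p_def)
  \<comment> \<open>The unary operation is either absorbed by g or it slides past g into x.\<close>
  consider "p < j" | "j \<le> p" "p < j + k" | "j + k \<le> p" by linarith
  then show ?case
  proof cases
    case 1
    have "comp n 1 p (comp m k j x g) y = comp m k j (comp m 1 p x y) g"
      using base p 1 comp_assoc_parallel[of x m y 1 g k p j] by simp
    then show ?thesis
      using leaf_sum.base[of "comp m 1 p x y" m g k j r n] base p 1 perm eq comp_closed[of x m y 1 p]
      by auto
  next
    case 2
    define j' where "j' = p + 1 - j"
    have j': "p = j - 1 + j'" "j' \<in> {1..k}"
      using 2 base unfolding j'_def by auto
    have "comp n 1 p (comp m k j x g) y = comp m k j x (comp k 1 j' g y)"
      using base j' comp_assoc_sequential[of x m g k y 1 j j'] by simp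
    then show ?thesis
      using leaf_sum.base[of x m "comp k 1 j' g y" k j r n] base j' perm eq comp_closed[of g k y 1 j']
      by auto
  next
    case 3
    define q where "q = p + 1 - k"
    have q: "p = q - 1 + k" "j < q" "q \<le> m"
      using 3 base p unfolding q_def by auto
    have "comp n 1 p (comp m k j x g) y = comp m k j (comp m 1 q x y) g"
      using base q comp_assoc_parallel[of x m g k y 1 j q] by simp
    then show ?thesis
      using leaf_sum.base[of "comp m 1 q x y" m g k j r n] base q perm eq comp_closed[of x m y 1 q]
      by auto
  qed
next
  case (add n x x')
  then show ?case
    using leaf_sum_in_P by (auto simp: comp_add_left intro: leaf_sum.add)
qed (auto simp: comp_zero_left intro: leaf_sum.intros)

text \<open>In a tree of arity above r choose a vertex with several inputs as far from the root as
  possible. All that lies above it is unary and can be absorbed into it. In the induction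
  this happens in the composition step: a right factor of arity between 2 and r is itself such a
  vertex, a larger one already contains one, and a unary one is absorbed.\<close>

lemma generated_leaf_sum:
  assumes red: reduced and P: "\<And>n. P n = {x. generated G n x}"
    and G: "\<And>n x. (n, x) \<in> G \<Longrightarrow> n \<le> r" and r: "1 \<le> r"
  shows "generated G n x \<Longrightarrow> n \<le> r \<or> leaf_sum r n x"
proof (induction rule: generated.induct)
  case (comp m x n y i)
  have xy: "x \<in> P m" "y \<in> P n" using comp P by auto
  consider "m + n - 1 \<le> r" | "n = 0" | "r < m + n - 1" "n = 1" | "r < n"
    | "r < m + n - 1" "2 \<le> n" "n \<le> r" by linarith
  then show ?case
  proof cases
    case 2
    then have "comp m n i x y = 0"
      using red xy comp_zero_right comp(3) unfolding reduced_def by auto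
    then show ?thesis using leaf_sum.zero by auto
  next
    case 3
    then show ?thesis
      using comp leaf_sum_comp_unary xy by auto
  next
    case 4
    then show ?thesis
      using comp leaf_sum_comp_right xy by auto
  next
    case 5
    have "leaf_sum r (m + n - 1) (act (m + n - 1) (comp m n i x y) id)"
      by (intro leaf_sum.base xy comp 5 refl permutes_id)
    then show ?thesis using act_id comp_closed xy comp(3) by auto
  qed auto
qed (use r G in \<open>auto intro: leaf_sum.intros leaf_sum_scale leaf_sum_act\<close>)

end

section \<open>Tame arities\<close>

lemma transpose_conjugate:
  assumes "s permutes A"
  shows "s \<circ> transpose a b = transpose (s a) (s b) \<circ> s"
  unfolding transpose_comp_eq[OF permutes_bij[OF assms]] permutes_inverses(2)[OF assms] by (rule refl)

context symmetric_operad
begin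

definition transpositions_agree :: "nat \<Rightarrow> nat set \<Rightarrow> 'v \<Rightarrow> bool" where
  "transpositions_agree n A x \<longleftrightarrow> (\<forall>a\<in>A. \<forall>b\<in>A. \<forall>c\<in>A. \<forall>d\<in>A. a \<noteq> b \<longrightarrow> c \<noteq> d \<longrightarrow>
     act n x (transpose a b) = act n x (transpose c d))"

text \<open>Equivalently, the alternating group acts trivially on P n.\<close>

definition tame :: "nat \<Rightarrow> bool" where
  "tame n \<longleftrightarrow> (\<forall>x\<in>P n. transpositions_agree n {1..n} x)"

lemma transpositions_agreeD: "\<lbrakk>transpositions_agree n A x; a \<in> A; b \<in> A; c \<in> A; d \<in> A; a \<noteq> b; c \<noteq> d\<rbrakk>
    \<Longrightarrow> act n x (transpose a b) = act n x (transpose c d)"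
  unfolding transpositions_agree_def by blast

lemma transpositions_agree_zero: "A \<subseteq> {1..n} \<Longrightarrow> transpositions_agree n A 0"
  unfolding transpositions_agree_def using act_zero[OF permutes_swap_id] by (metis subsetD)

lemma transpositions_agree_add:
  assumes "x \<in> P n" "y \<in> P n" "transpositions_agree n A x" "transpositions_agree n A y" "A \<subseteq> {1..n}"
  shows "transpositions_agree n A (x + y)"
  unfolding transpositions_agree_def
proof (intro ballI impI)
  fix a b c d assume *: "a \<in> A" "b \<in> A" "c \<in> A" "d \<in> A" "a \<noteq> b" "c \<noteq> d"
  have p: "transpose u v permutes {1..n}" if "u \<in> A" "v \<in> A" for u v
    using that assms(5) by (intro permutes_swap_id) auto
  show "act n (x + y) (transpose a b) = act n (x + y) (transpose c d)"
    unfolding act_add[OF assms(1,2) p[OF *(1,2)]] act_add[OF assms(1,2) p[OF *(3,4)]]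
    by (simp only: transpositions_agreeD[OF assms(3) *] transpositions_agreeD[OF assms(4) *])
qed

lemma transpositions_agree_act:
  assumes x: "x \<in> P n" "transpositions_agree n {1..n} x" and s: "s permutes {1..n}"
  shows "transpositions_agree n {1..n} (act n x s)"
  unfolding transpositions_agree_def
proof (intro ballI impI)
  have *: "act n (act n x s) (transpose a b) = act n (act n x (transpose (s a) (s b))) s"
    "s a \<in> {1..n}" if "a \<in> {1..n}" "b \<in> {1..n}" for a b
  proof -
    show s1: "s a \<in> {1..n}" using permutes_in_image[OF s] that by blast
    have s2: "s b \<in> {1..n}" using permutes_in_image[OF s] that by blast
    show "act n (act n x s) (transpose a b) = act n (act n x (transpose (s a) (s b))) s"
      using act_act[OF x(1) s permutes_swap_id[OF that]] act_act[OF x(1) permutes_swap_id[OF s1 s2] s]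
        transpose_conjugate[OF s] by simp
  qed
  fix a b c d assume abcd: "a \<in> {1..n}" "b \<in> {1..n}" "c \<in> {1..n}" "d \<in> {1..n}" "a \<noteq> b" "c \<noteq> d"
  have "s a \<noteq> s b" "s c \<noteq> s d"
    using abcd permutes_inj[OF s] by (auto dest: injD)
  then show "act n (act n x s) (transpose a b) = act n (act n x s) (transpose c d)"
    unfolding *(1)[OF abcd(1,2)] *(1)[OF abcd(3,4)]
    using transpositions_agreeD[OF x(2) *(2)[OF abcd(1,2)] *(2)[OF abcd(2,1)] *(2)[OF abcd(3,4)] *(2)[OF abcd(4,3)]]
    by simp
qed

text \<open>The alternating groups on two sets that share two letters generate the alternating group on
  their union: for a outside B and b outside A, \<open>(a b) = (a p)(b p)(a p)\<close>.\<close>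

lemma transpositions_agree_Un:
  assumes x: "x \<in> P n" and AB: "transpositions_agree n A x" "transpositions_agree n B x" "A \<union> B = {1..n}"
    and pq: "p \<in> A \<inter> B" "q \<in> A \<inter> B" "p \<noteq> q"
  shows "transpositions_agree n {1..n} x"
proof -
  have pX: "transpose u v permutes {1..n}" if "u \<in> A \<union> B" "v \<in> A \<union> B" for u v
    using that AB(3) by (intro permutes_swap_id) auto
  have mixed: "act n x (transpose a b) = act n x (transpose p q)"
    if ab: "a \<in> A - B" "b \<in> B - A" for a b
  proof -
    have ap: "act n x (transpose a p) = act n x (transpose p q)"
      using ab pq by (intro transpositions_agreeD[OF AB(1)]) auto
    have bp: "act n x (transpose b p) = act n x (transpose p q)"
      using ab pq by (intro transpositions_agreeD[OF AB(2)]) auto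
    have perm: "transpose a p permutes {1..n}" "transpose b p permutes {1..n}"
      using ab pq pX[of a p] pX[of b p] by auto
    have "transpose a b = transpose a p \<circ> transpose b p \<circ> transpose a p"
      using ab pq by (auto simp: fun_eq_iff transpose_def)
    then have "act n x (transpose a b) = act n (act n (act n x (transpose a p)) (transpose b p)) (transpose a p)"
      using x perm by (simp add: act_act act_closed permutes_compose)
    also have "\<dots> = act n (act n (act n x (transpose b p)) (transpose b p)) (transpose a p)"
      using ap bp by simp
    also have "\<dots> = act n x (transpose a p)"
      using x perm by (simp add: act_act act_id)
    finally show ?thesis using ap by simp
  qed
  have "act n x (transpose a b) = act n x (transpose p q)"
    if ab: "a \<in> {1..n}" "b \<in> {1..n}" "a \<noteq> b" for a b
  proof -
    have abU: "a \<in> A \<union> B" "b \<in> A \<union> B" using ab AB(3) by simp_all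
    consider "a \<in> A" "b \<in> A" | "a \<in> B" "b \<in> B" | "a \<in> A - B" "b \<in> B - A" | "b \<in> A - B" "a \<in> B - A"
      using abU by blast
    then show ?thesis
    proof cases
      case 1
      then show ?thesis using ab pq by (intro transpositions_agreeD[OF AB(1)]) auto
    next
      case 2
      then show ?thesis using ab pq by (intro transpositions_agreeD[OF AB(2)]) auto
    next
      case 3
      then show ?thesis using mixed by auto
    next
      case 4
      then show ?thesis using mixed[of b a] by (simp add: transpose_commute)
    qed
  qed
  then show ?thesis unfolding transpositions_agree_def by (intro ballI impI) (rule trans[OF _ sym])
qed

text \<open>The symmetry of the left factor survives on the inputs off the grafted block.\<close>

lemma tame_comp_agree:
  assumes "tame m" "x \<in> P m" "g \<in> P k" "1 \<le> k" "i \<in> {1..m}"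
  shows "transpositions_agree (m + k - 1) ({1..m + k - 1} - {i..<i + k}) (comp m k i x g)"
proof -
  define c where "c a = (if a < i then a else a + 1 - k)" for a
  let ?A = "{1..m + k - 1} - {i..<i + k}"
  have c: "c a \<in> {1..m}" "c a \<noteq> i" "(if c a < i then c a else c a + k - 1) = a" if "a \<in> ?A" for a
    using that assms(4,5) by (auto simp: c_def)
  have *: "act (m + k - 1) (comp m k i x g) (transpose a b) = comp m k i (act m x (transpose (c a) (c b))) g"
    if ab: "a \<in> ?A" "b \<in> ?A" for a b
  proof -
    have t: "transpose (c a) (c b) permutes {1..m}"
      using c ab by (intro permutes_swap_id) auto
    have "outer_perm k i (transpose (c a) (c b)) = transpose a b"
      using outer_perm_transpose[of k "c a" i "c b"] assms(4) c[OF ab(1)] c[OF ab(2)] by simp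
    then show ?thesis
      using comp_act_left[OF assms(2,3,5) t] c(2)[OF ab(1)] c(2)[OF ab(2)] by simp
  qed
  have ag: "transpositions_agree m {1..m} x"
    using assms(1,2) unfolding tame_def by blast
  have inj: "c a \<noteq> c b" if "a \<in> ?A" "b \<in> ?A" "a \<noteq> b" for a b
  proof
    assume "c a = c b"
    then have "(if c a < i then c a else c a + k - 1) = (if c b < i then c b else c b + k - 1)"
      by (simp only:)
    then show False unfolding c(3)[OF that(1)] c(3)[OF that(2)] using that(3) by contradiction
  qed
  show ?thesis
    unfolding transpositions_agree_def
  proof (intro ballI impI)
    fix a b p q assume abpq: "a \<in> ?A" "b \<in> ?A" "p \<in> ?A" "q \<in> ?A" "a \<noteq> b" "p \<noteq> q"
    have "act m x (transpose (c a) (c b)) = act m x (transpose (c p) (c q))"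
      by (rule transpositions_agreeD[OF ag c(1)[OF abpq(1)] c(1)[OF abpq(2)] c(1)[OF abpq(3)] c(1)[OF abpq(4)]
            inj[OF abpq(1,2,5)] inj[OF abpq(3,4,6)]])
    then show "act (m + k - 1) (comp m k i x g) (transpose a b)
        = act (m + k - 1) (comp m k i x g) (transpose p q)"
      unfolding *[OF abpq(1,2)] *[OF abpq(3,4)] by (rule arg_cong)
  qed
qed

lemma tame_act_cases:
  assumes tame: "tame n" and s: "s permutes {1..n}" and ab: "a \<in> {1..n}" "b \<in> {1..n}" "a \<noteq> b"
  shows "x \<in> P n \<Longrightarrow> act n x s = x \<or> act n x s = act n x (transpose a b)"
  using s finite_atLeastAtMost[of 1 n]
proof (induction s arbitrary: x rule: permutes_induct)
  case id
  then show ?case by (intro disjI1 act_id)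
next
  case (swap c d s)
  have pcd: "transpose c d permutes {1..n}" and pab: "transpose a b permutes {1..n}"
    using swap ab by (auto intro!: permutes_swap_id)
  have eq: "act n x (transpose c d \<circ> s) = act n (act n x (transpose c d)) s"
    using act_act[OF swap.prems pcd swap.hyps(4)] by simp
  show ?case
  proof (cases "c = d")
    case True
    then show ?thesis using swap by simp
  next
    case False
    have "act n x (transpose c d) = act n x (transpose a b)"
      using tame swap.hyps(1,2) swap.prems ab False unfolding tame_def by (intro transpositions_agreeD) auto
    then have "act n x (transpose c d \<circ> s) = act n (act n x (transpose a b)) s"
      using eq by simp
    moreover have "act n (act n x (transpose a b)) (transpose a b) = x"
      using swap.prems pab by (simp add: act_act act_id)
    ultimately show ?thesis
      using swap.IH[OF act_closed[OF swap.prems pab]] by metis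
  qed
qed

text \<open>
  An element of P N is a sum of permuted compositions \<open>x \<circ>\<^sub>i g\<close>, and x in turn is a sum of permuted
  compositions \<open>y \<circ>\<^sub>j h\<close>. As x lives in a tame arity, g can be moved to an input of x off the
  block of h. The result has the blocks of both g and h at its top. Removing g or removing h leaves
  an operation of tame arity, so the transpositions avoiding the block of g agree, and so do those
  avoiding the block of h. The blocks are disjoint, and the bound on N leaves two inputs that
  belong to neither, so all transpositions agree.
\<close>

lemma tame_step:
  assumes r: "2 \<le> r" and leaf: "\<And>n x. r < n \<Longrightarrow> x \<in> P n \<Longrightarrow> leaf_sum r n x"
    and N: "2 * r + 2 \<le> N" and prev: "\<And>n. N < n + r \<Longrightarrow> n < N \<Longrightarrow> tame n"
  shows "tame N"
proof -
  have two_tops: "transpositions_agree N {1..N} (comp n k (l + 1) (comp q l 1 y h) g)"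
    if "y \<in> P q" "h \<in> P l" "g \<in> P k" "2 \<le> l" "l \<le> r" "2 \<le> k" "k \<le> r"
      "n = q + l - 1" "N = n + k - 1" for n k l q y h g
  proof -
    have q: "4 \<le> q" "l + 1 \<le> n" using that N by auto
    define n2 where "n2 = q + k - 1"
    have N2: "N = n2 + l - 1" unfolding n2_def using that by auto
    have gd: "tame n" "tame n2"
      unfolding n2_def using that q by (auto intro!: prev)
    have P: "comp q l 1 y h \<in> P n" "comp q k 2 y g \<in> P n2"
      unfolding n2_def that(8) using that q comp_closed[OF that(1,2), of 1] comp_closed[OF that(1,3), of 2] by auto
    let ?z = "comp n k (l + 1) (comp q l 1 y h) g"
    have z: "?z = comp n2 l 1 (comp q k 2 y g) h"
      using comp_assoc_parallel[of y q h l g k 1 2] that q unfolding n2_def by (simp add: add.commute)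
    have A1: "transpositions_agree N ({1..N} - {l + 1..<l + 1 + k}) ?z"
      using tame_comp_agree[OF gd(1) P(1) that(3), of "l + 1"] that q by simp
    have A2: "transpositions_agree N ({1..N} - {1..<1 + l}) ?z"
      using tame_comp_agree[OF gd(2) P(2) that(2), of 1] that(4) z N2 q unfolding n2_def by simp
    have "?z \<in> P N"
      using comp_closed[OF P(1) that(3), of "l + 1"] that q by simp
    then show ?thesis
      using that q by (intro transpositions_agree_Un[OF _ A1 A2, of "N - 1" N]) auto
  qed
  have one_top: "transpositions_agree N {1..N} (comp n k p (comp q l 1 y h) g)"
    if asm: "y \<in> P q" "h \<in> P l" "g \<in> P k" "2 \<le> l" "l \<le> r" "2 \<le> k" "k \<le> r"
      "n = q + l - 1" "N = n + k - 1" "p \<in> {1..n}" for n k l q y h g p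
  proof -
    have q: "4 \<le> q" "l + 1 \<in> {1..n}" using asm N by auto
    have gd: "tame n" using asm q by (auto intro!: prev)
    define v where "v = comp q l 1 y h"
    have v: "v \<in> P n"
      unfolding v_def asm(8) using q comp_closed[OF asm(1,2), of 1] by auto
    obtain y' where y': "y' \<in> P q" "act n v (transpose p (l + 1)) = comp q l 1 y' h"
    proof (cases "p = l + 1")
      case True
      then show ?thesis using asm(1) v act_id[OF v] by (intro that(1)[of y]) (auto simp: v_def)
    next
      case False
      \<comment> \<open>Since n is tame, the transposition may be replaced by one that avoids the block of h.\<close>
      have "act n v (transpose p (l + 1)) = act n v (transpose (l + 1) (l + 2))"
        using gd v False asm q unfolding tame_def by (intro transpositions_agreeD[of n "{1..n}"]) auto
      also have "\<dots> = comp q l 1 (act q y (transpose 2 3)) h"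
        using comp_act_left[OF asm(1,2), of 1 "transpose 2 3"] outer_perm_transpose[of l 2 1 3] asm q
        by (auto simp: v_def permutes_swap_id)
      finally show ?thesis
        using act_closed[OF asm(1), of "transpose 2 3"] q
        by (intro that(1)[of "act q y (transpose 2 3)"]) (auto simp: permutes_swap_id)
    qed
    have "comp n k p v g = act N (comp n k (l + 1) (comp q l 1 y' h) g) (outer_perm k p (transpose p (l + 1)))"
      using comp_change_input[OF v asm(3), of p "l + 1"] asm q y' by simp
    moreover have "outer_perm k p (transpose p (l + 1)) permutes {1..N}"
      using outer_perm_permutes[of "transpose p (l + 1)" n p k] asm q by (auto simp: permutes_swap_id)
    moreover have "comp n k (l + 1) (comp q l 1 y' h) g \<in> P N"
      using comp_closed[of "comp q l 1 y' h" n g k "l + 1"] comp_closed[of y' q h l 1] y' asm q by auto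
    ultimately show ?thesis
      using transpositions_agree_act[OF _ two_tops[OF y'(1) asm(2-9)]] by (simp add: v_def)
  qed
  have comp_agree: "transpositions_agree N {1..N} (comp n k i x g)"
    if "leaf_sum r n x" "g \<in> P k" "2 \<le> k" "k \<le> r" "N = n + k - 1" "i \<in> {1..n}" for n k i x g
    using that
  proof (induction arbitrary: i rule: leaf_sum.induct)
    case (base y q h l j n s)
    define v where "v = comp q l 1 (act q y (transpose j 1)) h"
    define t where "t = outer_perm l j (transpose j 1)"
    have t: "t permutes {1..n}"
      unfolding t_def using outer_perm_permutes[of "transpose j 1" q j l] base by (auto simp: permutes_swap_id)
    have st: "t \<circ> s permutes {1..n}"
      using base t by (intro permutes_compose)
    have y: "act q y (transpose j 1) \<in> P q"
      using base by (intro act_closed permutes_swap_id) auto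
    have v: "v \<in> P n"
      unfolding v_def base(6) using base y by (intro comp_closed) auto
    have "comp q l j y h = act n v t"
      using comp_change_input[of y q h l j 1] base unfolding v_def t_def by simp
    then have "act n (comp q l j y h) s = act n v (t \<circ> s)"
      using v t base by (simp add: act_act)
    then have "comp n k i (act n (comp q l j y h) s) g
        = act N (comp n k ((t \<circ> s) i) v g) (outer_perm k i (t \<circ> s))"
      using comp_act_left[OF v base(8) base(12) st] base by simp
    moreover have i: "(t \<circ> s) i \<in> {1..n}"
      using permutes_in_image[OF st, of i] base.prems by simp
    moreover have "outer_perm k i (t \<circ> s) permutes {1..N}"
      using outer_perm_permutes[OF st, of i k] base by auto
    moreover have "transpositions_agree N {1..N} (comp n k ((t \<circ> s) i) v g)"
      unfolding v_def using one_top[OF y base(2) base(8)] base i by auto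
    moreover have "comp n k ((t \<circ> s) i) v g \<in> P N"
      using comp_closed[OF v base(8) i] base by simp
    ultimately show ?case by (simp only: transpositions_agree_act)
  next
    case (zero n)
    then show ?case by (simp add: comp_zero_left transpositions_agree_zero)
  next
    case (add n x y)
    have P: "x \<in> P n" "y \<in> P n" using add.hyps by (simp_all add: leaf_sum_in_P)
    have "comp n k i x g \<in> P N" "comp n k i y g \<in> P N"
      using comp_closed[OF P(1) add.prems(1,5)] comp_closed[OF P(2) add.prems(1,5)] add.prems(4) by simp_all
    then show ?case
      unfolding comp_add_left[OF P add.prems(1,5)] using add.IH add.prems by (intro transpositions_agree_add) auto
  qed
  have "transpositions_agree N' {1..N'} x" if "leaf_sum r N' x" "N' = N" for x N'
    using that
  proof (induction rule: leaf_sum.induct)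
    case (base x m g k i n s)
    have m: "r < m" using base N by auto
    have "transpositions_agree N {1..N} (comp m k i x g)"
      using comp_agree[OF leaf[OF m base(1)] base(2)] base by auto
    moreover have "comp m k i x g \<in> P N"
      using comp_closed[of x m g k i] base by simp
    ultimately show ?case
      using transpositions_agree_act[OF _ _ base(7)] base.prems by simp
  next
    case (add n x y)
    show ?case
      using add.IH add.prems by (intro transpositions_agree_add leaf_sum_in_P[OF add.hyps(1)] leaf_sum_in_P[OF add.hyps(2)]) auto
  qed (simp add: transpositions_agree_zero)
  moreover have "r < N" using N by simp
  ultimately show ?thesis
    unfolding tame_def using leaf by simp
qed

lemma tame_propagates:
  assumes r: "2 \<le> r" and leaf: "\<And>n x. r < n \<Longrightarrow> x \<in> P n \<Longrightarrow> leaf_sum r n x"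
    and m: "2 * r + 2 \<le> m" and window: "\<And>n. m \<le> n \<Longrightarrow> n + 1 < m + r \<Longrightarrow> tame n"
  shows "m \<le> n \<Longrightarrow> tame n"
proof (induction n rule: less_induct)
  case (less n)
  show ?case
  proof (cases "n + 1 < m + r")
    case True
    then show ?thesis using window less by simp
  next
    case False
    show ?thesis
    proof (rule tame_step[OF r])
      show "leaf_sum r k x" if "r < k" "x \<in> P k" for k x
        using leaf that .
      show "2 * r + 2 \<le> n" using m less.prems by simp
      show "tame k" if "n < k + r" "k < n" for k
        using less.IH[OF that(2)] that False by simp
    qed
  qed
qed

lemma tame_if_small_dim:
  assumes "locally_finite" "2 * dim (P n) + 5 \<le> n"
  shows "tame n"
proof -
  obtain B where B: "finite B" "span B = P n"
    using assms unfolding locally_finite_def by blast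
  note pm = permutation_module_P[of n]
  have st: "permutation_module.stable (act n) {1..n} (P n)" "permutation_module.stable (act n) {1..n} {0}"
    unfolding permutation_module.stable_def[OF pm] by (auto simp: act_closed act_zero)
  have "act n x (transpose a b) - act n x (transpose c d) \<in> {0}"
    if "x \<in> P n" "a \<in> {1..n}" "b \<in> {1..n}" "c \<in> {1..n}" "d \<in> {1..n}" "a \<noteq> b" "c \<noteq> d" for x a b c d
  proof (rule permutation_module.small_module_transpositions_agree[OF pm])
    show "{0} \<subseteq> P n" using subspace_0[OF subspace_P, of n] by simp
    show "P n \<subseteq> span B" "finite B" using B by simp_all
    show "dim (P n) \<le> dim {0} + dim (P n)" by simp
    show "2 * dim (P n) + 5 \<le> card {1..n}" using assms(2) by simp
  qed (fact st subspace_P subspace_single_0 that order.refl finite_atLeastAtMost)+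
  then have "act n x (transpose a b) = act n x (transpose c d)"
    if "x \<in> P n" "a \<in> {1..n}" "b \<in> {1..n}" "c \<in> {1..n}" "d \<in> {1..n}" "a \<noteq> b" "c \<noteq> d" for x a b c d
    using that by (simp only: singleton_iff right_minus_eq)
  then show ?thesis
    unfolding tame_def transpositions_agree_def by blast
qed

end

section \<open>Sets of monomials closed under division\<close>

text \<open>Monomials in the variables \<open>0, \<dots>, s - 1\<close> are represented by the multisets of their variables.\<close>

lemma finite_bounded_multisets:
  "finite {A :: nat multiset. set_mset A \<subseteq> {..<s} \<and> size A \<le> n}"
proof -
  have "{A :: nat multiset. set_mset A \<subseteq> {..<s} \<and> size A \<le> n}
      \<subseteq> mset ` {xs. set xs \<subseteq> {..<s} \<and> length xs \<le> n}"
  proof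
    fix A :: "nat multiset" assume A: "A \<in> {A. set_mset A \<subseteq> {..<s} \<and> size A \<le> n}"
    obtain xs where "mset xs = A" using ex_mset by blast
    then show "A \<in> mset ` {xs. set xs \<subseteq> {..<s} \<and> length xs \<le> n}"
      using A by (intro image_eqI[of _ _ xs]) auto
  qed
  then show ?thesis
    using finite_lists_length_le[of "{..<s}" n] finite_subset by blast
qed

lemma size_le_weight:
  fixes w :: "nat \<Rightarrow> nat"
  assumes "\<And>j. 1 \<le> w j"
  shows "size A \<le> (\<Sum>j\<in>#A. w j)"
proof (induction A)
  case (add j A)
  then show ?case using assms[of j] by simp
qed simp

lemma finite_multisets_of_weight:
  fixes w :: "nat \<Rightarrow> nat"
  assumes "\<And>j. 1 \<le> w j"
  shows "finite {A. set_mset A \<subseteq> {..<s} \<and> (\<Sum>j\<in>#A. w j) = n}"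
  by (rule finite_subset[OF _ finite_bounded_multisets[of s n]])
    (use size_le_weight[of w, OF assms] in auto)

text \<open>If S does not contain all monomials in the two variables i and j, then, being closed under
  division, it contains no monomial in which both have large exponents. If this holds for all
  pairs, then with a common bound K a monomial in S has at most one exponent that is K or more. The
  other exponents leave finitely many possibilities, and the weight determines the large one.\<close>

lemma order_ideal_dichotomy:
  fixes w :: "nat \<Rightarrow> nat" and S :: "nat multiset set"
  assumes w: "\<And>j. 1 \<le> w j" and S: "\<And>A. A \<in> S \<Longrightarrow> set_mset A \<subseteq> {..<s}"
    and down: "\<And>A B. A \<in> S \<Longrightarrow> B \<subseteq># A \<Longrightarrow> B \<in> S"
  shows "(\<exists>i<s. \<exists>j<s. i \<noteq> j \<and> (\<forall>a c. replicate_mset a i + replicate_mset c j \<in> S))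
    \<or> (\<exists>C. \<forall>n. card {A \<in> S. (\<Sum>j\<in>#A. w j) = n} \<le> C)"
proof (rule disjCI)
  assume no: "\<nexists>C. \<forall>n. card {A \<in> S. (\<Sum>j\<in>#A. w j) = n} \<le> C"
  show "\<exists>i<s. \<exists>j<s. i \<noteq> j \<and> (\<forall>a c. replicate_mset a i + replicate_mset c j \<in> S)"
  proof (rule ccontr)
    assume "\<not> ?thesis"
    then have "\<forall>p\<in>{..<s} \<times> {..<s}. \<exists>k. fst p \<noteq> snd p \<longrightarrow>
        (\<exists>a\<le>k. \<exists>c\<le>k. replicate_mset a (fst p) + replicate_mset c (snd p) \<notin> S)"
      by (metis lessThan_iff max.cobounded1 max.cobounded2 mem_Times_iff)
    from bchoice[OF this] obtain k where k: "\<forall>p\<in>{..<s} \<times> {..<s}. fst p \<noteq> snd p \<longrightarrow>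
        (\<exists>a\<le>k p. \<exists>c\<le>k p. replicate_mset a (fst p) + replicate_mset c (snd p) \<notin> S)"
      by blast
    define K where "K = Suc (\<Sum>p\<in>{..<s} \<times> {..<s}. k p)"
    have kK: "k p \<le> K" if "p \<in> {..<s} \<times> {..<s}" for p
      unfolding K_def using member_le_sum[of p "{..<s} \<times> {..<s}" k] that by simp
    have one_big: "\<not> (K \<le> count A i \<and> K \<le> count A j)"
      if ij: "A \<in> S" "i < s" "j < s" "i \<noteq> j" for A i j
    proof
      assume big: "K \<le> count A i \<and> K \<le> count A j"
      obtain a c where ac: "a \<le> k (i, j)" "c \<le> k (i, j)" "replicate_mset a i + replicate_mset c j \<notin> S"
        using bspec[OF k, of "(i, j)"] ij by auto
      have "replicate_mset a i + replicate_mset c j \<subseteq># A"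
        using ac(1,2) kK[of "(i, j)"] big ij by (auto simp: subseteq_mset_def)
      then show False using down ij(1) ac(3) by blast
    qed
    define BB where "BB = {B :: nat multiset. set_mset B \<subseteq> {..<s} \<and> (\<forall>j. count B j < K)}"
    have "size B \<le> s * K" if "B \<in> BB" for B
    proof -
      have "size B = (\<Sum>j\<in>{..<s}. count B j)"
        using that unfolding BB_def size_multiset_overloaded_eq
        by (intro sum.mono_neutral_left) (auto simp: not_in_iff)
      also have "\<dots> \<le> (\<Sum>j\<in>{..<s}. K)"
        using that unfolding BB_def by (intro sum_mono) (auto intro: less_imp_le)
      finally show ?thesis by simp
    qed
    then have finBB: "finite BB"
      by (intro finite_subset[OF _ finite_bounded_multisets[of s "s * K"]]) (auto simp: BB_def)
    define T where "T n i = {A \<in> S. (\<Sum>j\<in>#A. w j) = n \<and> filter_mset (\<lambda>j. j \<noteq> i) A \<in> BB}" for n i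
    have cover: "{A \<in> S. (\<Sum>j\<in>#A. w j) = n} \<subseteq> (\<Union>i\<le>s. T n i)" for n
    proof
      fix A assume A: "A \<in> {A \<in> S. (\<Sum>j\<in>#A. w j) = n}"
      \<comment> \<open>The index s, which is not a variable, serves for those A whose exponents are all below K.\<close>
      obtain i where i: "i \<le> s" "\<And>j. j \<noteq> i \<Longrightarrow> count A j < K"
      proof (cases "\<exists>i<s. K \<le> count A i")
        case True
        then obtain i where i: "i < s" "K \<le> count A i" by blast
        have "count A j < K" if "j \<noteq> i" for j
        proof (cases "j < s")
          case True
          then show ?thesis using one_big[of A i j] i A that by auto
        next
          case False
          then have "j \<notin># A" using S[of A] A by auto
          then show ?thesis by (simp add: K_def not_in_iff)
        qed
        then show ?thesis using that[of i] i(1) by auto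
      next
        case False
        have "count A j < K" for j
        proof (cases "j < s")
          case True
          then show ?thesis using False by (meson not_le)
        next
          case False
          then have "j \<notin># A" using S[of A] A by auto
          then show ?thesis by (simp add: K_def not_in_iff)
        qed
        then show ?thesis using that[of s] by auto
      qed
      have "filter_mset (\<lambda>j. j \<noteq> i) A \<in> BB"
        unfolding BB_def using S[of A] A i(2) by (auto simp: K_def)
      then show "A \<in> (\<Union>i\<le>s. T n i)"
        using A i(1) unfolding T_def by auto
    qed
    have inj: "inj_on (filter_mset (\<lambda>j. j \<noteq> i)) (T n i)" for n i
    proof (rule inj_onI)
      fix A B assume AB: "A \<in> T n i" "B \<in> T n i"
        "filter_mset (\<lambda>j. j \<noteq> i) A = filter_mset (\<lambda>j. j \<noteq> i) B"
      have split: "A = filter_mset (\<lambda>j. j \<noteq> i) A + replicate_mset (count A i) i" for A :: "nat multiset"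
        by (rule multiset_eqI) auto
      have wt: "(\<Sum>j\<in>#A. w j) = (\<Sum>j\<in>#filter_mset (\<lambda>j. j \<noteq> i) A. w j) + count A i * w i" for A
        by (subst split[of A]) (simp only: image_mset_union sum_mset.union image_replicate_mset sum_mset_replicate_mset of_nat_id mult.commute)
      have "count A i * w i = count B i * w i"
      proof -
        have "(\<Sum>j\<in>#A. w j) = n" "(\<Sum>j\<in>#B. w j) = n" using AB(1,2) unfolding T_def by auto
        then show ?thesis using wt[of A, unfolded AB(3)] wt[of B] by linarith
      qed
      then have "count A i = count B i"
        using w[of i] by simp
      then show "A = B"
        using split[of A] split[of B] AB(3) by simp
    qed
    have fin: "finite (T n i)" and card: "card (T n i) \<le> card BB" for n i
    proof -
      have "filter_mset (\<lambda>j. j \<noteq> i) ` T n i \<subseteq> BB"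
        unfolding T_def by auto
      then show "card (T n i) \<le> card BB" "finite (T n i)"
        using card_inj_on_le[OF inj _ finBB] inj_on_finite[OF inj _ finBB] by auto
    qed
    have "card {A \<in> S. (\<Sum>j\<in>#A. w j) = n} \<le> Suc s * card BB" for n
    proof -
      have "card {A \<in> S. (\<Sum>j\<in>#A. w j) = n} \<le> card (\<Union>i\<le>s. T n i)"
        using fin by (intro card_mono[OF _ cover]) auto
      also have "\<dots> \<le> (\<Sum>i\<le>s. card (T n i))"
        by (rule card_UN_le) simp
      also have "\<dots> \<le> (\<Sum>i\<le>s. card BB)"
        by (intro sum_mono card)
      finally show ?thesis by simp
    qed
    then show False using no by blast
  qed
qed

section \<open>The module structure in tame arities\<close>

context symmetric_operad
begin

lemma subspace_comp_left_vimage: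
  assumes "g \<in> P k" "i \<in> {1..m}" "subspace T"
  shows "subspace {x \<in> P m. comp m k i x g \<in> T}"
  using assms
  by (intro subspaceI)
    (auto simp: comp_zero_left comp_add_left comp_scale_left subspace_0 subspace_add subspace_scale subspace_P)

lemma subspace_comp_right_vimage:
  assumes "x \<in> P m" "i \<in> {1..m}" "subspace T"
  shows "subspace {g \<in> P k. comp m k i x g \<in> T}"
  using assms
  by (intro subspaceI)
    (auto simp: comp_zero_right comp_add_right comp_scale_right subspace_0 subspace_add subspace_scale subspace_P)

lemma subspace_act_vimage:
  assumes "s permutes {1..n}" "subspace T"
  shows "subspace {x \<in> P n. act n x s \<in> T}"
  using assms
  by (intro subspaceI)
    (auto simp: act_zero act_add act_scale subspace_0 subspace_add subspace_scale subspace_P)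

definition submodule :: "nat \<Rightarrow> 'v set \<Rightarrow> bool" where
  "submodule n W \<longleftrightarrow> subspace W \<and> W \<subseteq> P n \<and> (\<forall>x\<in>W. \<forall>s. s permutes {1..n} \<longrightarrow> act n x s \<in> W)"

lemma submoduleD:
  assumes "submodule n W"
  shows "subspace W" "x \<in> W \<Longrightarrow> x \<in> P n" "x \<in> W \<Longrightarrow> s permutes {1..n} \<Longrightarrow> act n x s \<in> W"
  using assms unfolding submodule_def by blast+

end

text \<open>The operations \<open>gv j\<close> are the variables that act on the operad by composition, raising the arity
  by \<open>ar j - 1\<close>.\<close>

locale eventually_tame_operad = symmetric_operad scale P act one comp
  for scale :: "'k::field \<Rightarrow> 'v::ab_group_add \<Rightarrow> 'v"  (infixr \<open>*s\<close> 75)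
    and P :: "nat \<Rightarrow> 'v set"
    and act :: "nat \<Rightarrow> 'v \<Rightarrow> (nat \<Rightarrow> nat) \<Rightarrow> 'v"
    and one :: 'v
    and comp :: "nat \<Rightarrow> nat \<Rightarrow> nat \<Rightarrow> 'v \<Rightarrow> 'v \<Rightarrow> 'v" +
  fixes m0 :: nat and ar :: "nat \<Rightarrow> nat" and gv :: "nat \<Rightarrow> 'v"
  assumes tame: "m0 \<le> n \<Longrightarrow> tame n"
    and m0: "3 \<le> m0"
    and ar: "2 \<le> ar j"
    and gv: "gv j \<in> P (ar j)"
begin

definition mul :: "nat \<Rightarrow> nat \<Rightarrow> 'v \<Rightarrow> 'v" where
  "mul n j x = comp n (ar j) 1 x (gv j)"

definition wt :: "nat multiset \<Rightarrow> nat" where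
  "wt A = (\<Sum>j\<in>#A. ar j - 1)"

lemma wt_simps: "wt {#} = 0" "wt (add_mset j A) = (ar j - 1) + wt A"
  by (simp_all add: wt_def)

text \<open>Even permutations fix every element of tame arity, so it suffices to check invariance under one
  odd permutation, and a transposition of two inputs of the left factor serves.\<close>

lemma mul_submodule:
  assumes n: "m0 \<le> n" and W: "submodule n W"
  shows "submodule (n + (ar j - 1)) (mul n j ` W)"
  unfolding submodule_def
proof (intro conjI ballI allI impI)
  define N where "N = n + (ar j - 1)"
  have N: "N = n + ar j - 1" "m0 \<le> N" "ar j + 2 \<le> N"
    using ar[of j] n m0 unfolding N_def by auto
  have one_in: "(1::nat) \<in> {1..n}" using n m0 by auto
  note WP = submoduleD(2)[OF W]
  show "subspace (mul n j ` W)"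
  proof (rule subspaceI)
    show "0 \<in> mul n j ` W"
      using subspace_0[OF submoduleD(1)[OF W]] comp_zero_left[OF gv one_in] unfolding mul_def by force
  next
    fix x y assume "x \<in> mul n j ` W" "y \<in> mul n j ` W"
    then obtain u v where uv: "u \<in> W" "x = mul n j u" "v \<in> W" "y = mul n j v" by blast
    have "x + y = mul n j (u + v)"
      unfolding uv mul_def using comp_add_left[OF WP[OF uv(1)] WP[OF uv(3)] gv one_in] by simp
    then show "x + y \<in> mul n j ` W"
      using subspace_add[OF submoduleD(1)[OF W] uv(1,3)] by blast
  next
    fix c x assume "x \<in> mul n j ` W"
    then obtain u where u: "u \<in> W" "x = mul n j u" by blast
    have "c *s x = mul n j (c *s u)"
      unfolding u mul_def using comp_scale_left[OF WP[OF u(1)] gv one_in] by simp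
    then show "c *s x \<in> mul n j ` W"
      using subspace_scale[OF submoduleD(1)[OF W] u(1)] by blast
  qed
  show sub: "mul n j ` W \<subseteq> P (n + (ar j - 1))"
    using comp_closed[OF WP gv one_in] N(1) unfolding mul_def N_def by auto
  fix z s assume z: "z \<in> mul n j ` W" and s: "s permutes {1..n + (ar j - 1)}"
  then obtain x where x: "x \<in> W" "z = mul n j x" by blast
  have zP: "z \<in> P N" using z sub unfolding N_def by blast
  have t: "transpose 2 3 permutes {1..n}" using n m0 by (intro permutes_swap_id) auto
  \<comment> \<open>An odd permutation acts on the product like a transposition of inputs of its left factor.\<close>
  have eq: "act N z (transpose (ar j + 1) (ar j + 2)) = mul n j (act n x (transpose 2 3))"
    using comp_act_left[OF WP[OF x(1)] gv one_in t, of j] outer_perm_transpose[of "ar j" 2 1 3] ar[of j] N(1)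
    unfolding x(2) mul_def by simp
  have "act N z s = z \<or> act N z s = act N z (transpose (ar j + 1) (ar j + 2))"
    using tame_act_cases[OF tame[OF N(2)] s[folded N_def], of "ar j + 1" "ar j + 2"] N(3) zP by simp
  then show "act (n + (ar j - 1)) z s \<in> mul n j ` W"
    unfolding N_def[symmetric] eq using z submoduleD(3)[OF W x(1) t] by auto
qed

text \<open>On the level of invariant subspaces the input at which one composes is irrelevant.\<close>

lemma comp_in_mul_image:
  assumes n: "m0 \<le> n" and W: "submodule n W" and x: "x \<in> W" and i: "i \<in> {1..n}"
  shows "comp n (ar j) i x (gv j) \<in> mul n j ` W"
proof -
  have one_in: "1 \<in> {1..n}" using i by auto
  have t: "transpose i 1 permutes {1..n}" using i by (intro permutes_swap_id) auto
  have N: "n + ar j - 1 = n + (ar j - 1)" using ar[of j] by simp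
  have "comp n (ar j) i x (gv j)
      = act (n + (ar j - 1)) (mul n j (act n x (transpose i 1))) (outer_perm (ar j) i (transpose i 1))"
    using comp_change_input[OF submoduleD(2)[OF W x] gv _ i one_in] ar[of j] N
    unfolding mul_def by simp
  moreover have "outer_perm (ar j) i (transpose i 1) permutes {1..n + (ar j - 1)}"
    using outer_perm_permutes[OF t i, of "ar j"] ar[of j] N by simp
  ultimately show ?thesis
    using submoduleD(3)[OF mul_submodule[OF n W]] submoduleD(3)[OF W x t] by simp
qed

text \<open>Move the second factor to an input off the block of the first one; there the parallel
  associativity axiom exchanges the two. Only the images of invariant subspaces commute: the two
  composites themselves may differ by a permutation.\<close>

lemma mul_commute_subset:
  assumes n: "m0 \<le> n" and W: "submodule n W"
  shows "mul (n + (ar g - 1)) h ` mul n g ` W \<subseteq> mul (n + (ar h - 1)) g ` mul n h ` W"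
proof (clarify)
  fix x assume x: "x \<in> W"
  define k l where "k = ar g" and "l = ar h"
  have kl: "2 \<le> k" "2 \<le> l" unfolding k_def l_def by (rule ar)+
  define n1 n2 where "n1 = n + (k - 1)" and "n2 = n + (l - 1)"
  have n1: "n1 = n + k - 1" "m0 \<le> n1" "k + 1 \<in> {1..n1}" "1 \<in> {1..n1}" and n2: "n2 = n + l - 1" "m0 \<le> n2"
    unfolding n1_def n2_def using kl n m0 by auto
  have Wg: "submodule n1 (mul n g ` W)" and Wh: "submodule n2 (mul n h ` W)"
    unfolding n1_def n2_def k_def l_def by (rule mul_submodule[OF n W])+
  have Whg: "submodule (n2 + (k - 1)) (mul n2 g ` mul n h ` W)"
    unfolding k_def by (rule mul_submodule[OF n2(2) Wh])
  define y where "y = mul n g x"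
  have t: "transpose 1 (k + 1) permutes {1..n1}" using n1 by (intro permutes_swap_id)
  have "y \<in> mul n g ` W" unfolding y_def using x by blast
  then have y: "y \<in> P n1" "act n1 y (transpose 1 (k + 1)) \<in> mul n g ` W"
    using submoduleD(2,3)[OF Wg] t by auto
  then obtain x' where x': "x' \<in> W" "act n1 y (transpose 1 (k + 1)) = mul n g x'" by blast
  have N: "n1 + l - 1 = n2 + (k - 1)" unfolding n1_def n2_def using kl by simp
  have "comp n1 l (k + 1) (comp n k 1 x' (gv g)) (gv h) = comp n2 k 1 (comp n l 2 x' (gv h)) (gv g)"
    using comp_assoc_parallel[of x' n "gv g" k "gv h" l 1 2] submoduleD(2)[OF W x'(1)] gv[of g] gv[of h] n m0 n1 n2
    by (simp add: k_def l_def add.commute)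
  moreover have "comp n l 2 x' (gv h) \<in> mul n h ` W"
    unfolding l_def using n m0 by (intro comp_in_mul_image n W x') auto
  ultimately have "comp n1 l (k + 1) (mul n g x') (gv h) \<in> mul n2 g ` mul n h ` W"
    unfolding mul_def[of n g] mul_def[of n2 g] k_def by auto
  moreover have "mul n1 h y
      = act (n2 + (k - 1)) (comp n1 l (k + 1) (mul n g x') (gv h)) (outer_perm l 1 (transpose 1 (k + 1)))"
    using comp_change_input[OF y(1), of "gv h" l 1 "k + 1"] gv[of h] n1 kl x'(2) N
    unfolding mul_def[of n1 h] l_def by simp
  moreover have "outer_perm l 1 (transpose 1 (k + 1)) permutes {1..n2 + (k - 1)}"
    using outer_perm_permutes[OF t n1(4), of l] kl N by simp
  ultimately have "mul n1 h y \<in> mul n2 g ` mul n h ` W"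
    using submoduleD(3)[OF Whg] by simp
  then show "mul (n + (ar g - 1)) h (mul n g x) \<in> mul (n + (ar h - 1)) g ` mul n h ` W"
    unfolding y_def n1_def n2_def k_def l_def .
qed

primrec word_image :: "nat \<Rightarrow> nat list \<Rightarrow> 'v set" where
  "word_image b [] = P b"
| "word_image b (j # w) = mul (b + wt (mset w)) j ` word_image b w"

lemma submodule_word_image: "m0 \<le> b \<Longrightarrow> submodule (b + wt (mset w)) (word_image b w)"
proof (induction w)
  case Nil
  then show ?case by (simp add: submodule_def subspace_P act_closed wt_simps)
next
  case (Cons j w)
  then show ?case
    using mul_submodule[of "b + wt (mset w)" "word_image b w" j] by (simp add: wt_simps add_ac)
qed

lemma word_image_swap:
  assumes "m0 \<le> b"
  shows "word_image b (i # j # w) = word_image b (j # i # w)"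
  using mul_commute_subset[OF _ submodule_word_image[OF assms], of w i j]
    mul_commute_subset[OF _ submodule_word_image[OF assms], of w j i] assms
  by (simp add: wt_simps add_ac)

lemma word_image_rotate:
  assumes "m0 \<le> b"
  shows "word_image b (xs @ a # ys) = word_image b (a # xs @ ys)"
proof (induction xs)
  case (Cons x xs)
  have "word_image b ((x # xs) @ a # ys) = word_image b (x # a # xs @ ys)"
    using Cons by simp
  also have "\<dots> = word_image b (a # (x # xs) @ ys)"
    using word_image_swap[OF assms, of x a "xs @ ys"] by simp
  finally show ?case .
qed simp

lemma word_image_mset:
  assumes "m0 \<le> b"
  shows "mset v = mset w \<Longrightarrow> word_image b v = word_image b w"
proof (induction v arbitrary: w)
  case (Cons a v)
  then have "a \<in> set w" by (metis list.set_intros(1) set_mset_mset)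
  then obtain xs ys where w: "w = xs @ a # ys" by (meson split_list)
  then have "word_image b v = word_image b (xs @ ys)"
    using Cons by (intro Cons.IH) simp
  then show ?case
    using Cons.prems w word_image_rotate[OF assms, of xs a ys] by simp
qed simp

text \<open>The image of P b under the monomial A; the order in which the variables are applied is
  irrelevant by the preceding lemma, and the sorted one is a convenient choice.\<close>

definition monomial_image :: "nat \<Rightarrow> nat multiset \<Rightarrow> 'v set" where
  "monomial_image b A = word_image b (sorted_list_of_multiset A)"

lemma monomial_image_empty: "monomial_image b {#} = P b"
  by (simp add: monomial_image_def)

lemma monomial_image_add:
  assumes "m0 \<le> b"
  shows "monomial_image b (add_mset j A) = mul (b + wt A) j ` monomial_image b A"
proof -
  have "monomial_image b (add_mset j A) = word_image b (j # sorted_list_of_multiset A)"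
    unfolding monomial_image_def by (rule word_image_mset[OF assms]) simp
  then show ?thesis by (simp add: monomial_image_def)
qed

lemma submodule_monomial_image: "m0 \<le> b \<Longrightarrow> submodule (b + wt A) (monomial_image b A)"
  using submodule_word_image[of b "sorted_list_of_multiset A"] by (simp add: monomial_image_def)

end

section \<open>Standard monomials\<close>

locale monomial_operad = eventually_tame_operad scale P act one comp m0 ar gv
  for scale :: "'k::field \<Rightarrow> 'v::ab_group_add \<Rightarrow> 'v"  (infixr \<open>*s\<close> 75)
    and P :: "nat \<Rightarrow> 'v set"
    and act :: "nat \<Rightarrow> 'v \<Rightarrow> (nat \<Rightarrow> nat) \<Rightarrow> 'v"
    and one :: 'v
    and comp :: "nat \<Rightarrow> nat \<Rightarrow> nat \<Rightarrow> 'v \<Rightarrow> 'v \<Rightarrow> 'v"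
    and m0 :: nat and ar :: "nat \<Rightarrow> nat" and gv :: "nat \<Rightarrow> 'v" +
  fixes s r :: nat
  assumes leaf: "\<lbrakk>m0 \<le> n; x \<in> P n\<rbrakk> \<Longrightarrow> leaf_sum r n x"
    and spanning: "\<lbrakk>2 \<le> k; k \<le> r\<rbrakk> \<Longrightarrow> P k \<subseteq> span {gv j |j. j < s \<and> ar j = k}"
    and fin_dim: locally_finite
begin

definition monomials :: "nat \<Rightarrow> nat multiset set" where
  "monomials n = {A. set_mset A \<subseteq> {..<s} \<and> wt A = n}"

lemma finite_monomials: "finite (monomials n)"
  using finite_multisets_of_weight[of "\<lambda>j. ar j - 1" s n] ar
  unfolding monomials_def wt_def by (simp add: le_diff_conv2 Suc_le_eq numeral_2_eq_2)

lemma add_monomial: "A \<in> monomials n \<Longrightarrow> j < s \<Longrightarrow> add_mset j A \<in> monomials (n + (ar j - 1))"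
  by (auto simp: monomials_def wt_simps)

text \<open>The arities from \<open>m0\<close> to \<open>m0 + r - 1\<close> generate all later ones as a module, since removing an
  operation of arity at most r lowers the arity by less than r.\<close>

lemma monomials_span:
  "m0 \<le> n \<Longrightarrow> P n \<subseteq> span (\<Union>b\<in>{m0..<m0 + r}. \<Union>A\<in>{A. b \<le> n \<and> A \<in> monomials (n - b)}. monomial_image b A)"
proof (induction n rule: less_induct)
  case (less n)
  define U where "U n = (\<Union>b\<in>{m0..<m0 + r}. \<Union>A\<in>{A. b \<le> n \<and> A \<in> monomials (n - b)}. monomial_image b A)" for n
  show ?case
  proof (cases "n < m0 + r")
    case True
    have "{#} \<in> monomials 0" by (simp add: monomials_def wt_simps)
    then have "P n \<subseteq> U n"
      using True less.prems unfolding U_def by (force simp: monomial_image_empty)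
    then show ?thesis
      unfolding U_def[symmetric] using span_superset by blast
  next
    case False
    have UE: "\<exists>b A. x \<in> monomial_image b A \<and> b \<in> {m0..<m0 + r} \<and> b \<le> n \<and> A \<in> monomials (n - b) \<and> b + wt A = n"
      if "x \<in> U n" for x n
      using that unfolding U_def monomials_def by force
    have UI: "x \<in> U n"
      if "x \<in> monomial_image b A" "b \<in> {m0..<m0 + r}" "b \<le> n" "A \<in> monomials (n - b)" for x n b A
      using that unfolding U_def by blast
    have U_P: "U n \<subseteq> P n" for n
    proof
      fix x assume "x \<in> U n"
      then obtain b A where bA: "x \<in> monomial_image b A" "b \<in> {m0..<m0 + r}" "b + wt A = n"
        using UE by blast
      then show "x \<in> P n"
        using submoduleD(2)[OF submodule_monomial_image[of b A]] by simp
    qed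
    have U_act: "span (U n) \<subseteq> {x \<in> P n. act n x t \<in> span (U n)}" if t: "t permutes {1..n}" for t n
    proof (rule span_minimal[OF _ subspace_act_vimage[OF t subspace_span]], rule subsetI)
      fix x assume x: "x \<in> U n"
      then obtain b A where bA: "x \<in> monomial_image b A" "b \<in> {m0..<m0 + r}" "b \<le> n"
          "A \<in> monomials (n - b)" "b + wt A = n"
        using UE by blast
      then have "act n x t \<in> monomial_image b A"
        using submoduleD(3)[OF submodule_monomial_image[of b A]] t by simp
      then have "act n x t \<in> U n" by (rule UI) (rule bA)+
      then show "x \<in> {x \<in> P n. act n x t \<in> span (U n)}"
        using x U_P span_base by auto
    qed
    have step: "comp m k i x g \<in> span (U (m + k - 1))"
      if mk: "m0 \<le> m" "2 \<le> k" "k \<le> r" "i \<in> {1..m}" and x: "x \<in> span (U m)" and g: "g \<in> P k" for m k i x g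
    proof -
      have gen: "comp m k i y g \<in> span (U (m + k - 1))" if y: "y \<in> U m" for y
      proof -
        obtain b A where bA: "y \<in> monomial_image b A" "b \<in> {m0..<m0 + r}" "b \<le> m"
            "A \<in> monomials (m - b)" "b + wt A = m"
          using UE[OF y] by blast
        have "{gv j |j. j < s \<and> ar j = k} \<subseteq> {h \<in> P k. comp m k i y h \<in> span (U (m + k - 1))}"
        proof (rule subsetI)
          fix h assume "h \<in> {gv j |j. j < s \<and> ar j = k}"
          then obtain j where j: "h = gv j" "j < s" "ar j = k" by blast
          have "comp m k i y h \<in> mul m j ` monomial_image b A"
            using comp_in_mul_image[of m "monomial_image b A" y i j] submodule_monomial_image[of b A] bA mk j
            by simp
          then have "comp m k i y h \<in> monomial_image b (add_mset j A)"
            using monomial_image_add[of b j A] bA by simp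
          moreover have "add_mset j A \<in> monomials (m + k - 1 - b)"
            using add_monomial[OF bA(4) j(2)] bA(3) j(3) mk by simp
          moreover have "b \<le> m + k - 1" using bA(3) mk(2) by simp
          ultimately have "comp m k i y h \<in> U (m + k - 1)"
            using bA(2) by (intro UI)
          then show "h \<in> {h \<in> P k. comp m k i y h \<in> span (U (m + k - 1))}"
            using gv[of j] j span_base by auto
        qed
        then have "span {gv j |j. j < s \<and> ar j = k} \<subseteq> {h \<in> P k. comp m k i y h \<in> span (U (m + k - 1))}"
          using y U_P[of m] mk(4) by (intro span_minimal subspace_comp_right_vimage subspace_span) auto
        then show ?thesis using spanning[OF mk(2,3)] g by blast
      qed
      have "span (U m) \<subseteq> {y \<in> P m. comp m k i y g \<in> span (U (m + k - 1))}"
        using gen U_P[of m] by (intro span_minimal subspace_comp_left_vimage[OF g mk(4)] subspace_span) auto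
      then show ?thesis using x by blast
    qed
    have "N = n \<Longrightarrow> x \<in> span (U n)" if "leaf_sum r N x" for N x
      using that
    proof (induction rule: leaf_sum.induct)
      case (base x m g k i N t)
      have m: "m0 \<le> m" "m < n" using base False by auto
      have "x \<in> span (U m)"
        using less.IH[OF m(2,1)] base(1) unfolding U_def by blast
      then have "comp m k i x g \<in> span (U n)"
        using step[OF m(1) base(4,5,3) _ base(2)] base by simp
      then show ?case
        using U_act[of t n] base by auto
    next
      case (zero N)
      then show ?case using span_zero by simp
    next
      case (add N x y)
      then show ?case using span_add by simp
    qed
    then show ?thesis
      unfolding U_def[symmetric] using leaf[OF less.prems] by blast
  qed
qed

text \<open>The following two notions are those of Groebner basis theory. The multiset order \<open><\<close> is a
  monomial order: it is total, well-founded and compatible with multiplication.\<close>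

definition lower :: "nat \<Rightarrow> nat multiset \<Rightarrow> 'v set" where
  "lower b A = span (\<Union>B\<in>{B \<in> monomials (wt A). B < A}. monomial_image b B)"

definition standard :: "nat \<Rightarrow> nat multiset set" where
  "standard b = {A. set_mset A \<subseteq> {..<s} \<and> \<not> monomial_image b A \<subseteq> lower b A}"

lemma lower_mul:
  assumes b: "m0 \<le> b" and j: "j < s"
  shows "mul (b + wt A) j ` lower b A \<subseteq> lower b (add_mset j A)"
proof -
  have b1: "1 \<in> {1..b + wt A}" using b m0 by auto
  have "(\<Union>B\<in>{B \<in> monomials (wt A). B < A}. monomial_image b B)
      \<subseteq> {x \<in> P (b + wt A). comp (b + wt A) (ar j) 1 x (gv j) \<in> lower b (add_mset j A)}"
  proof (rule subsetI)
    fix x assume "x \<in> (\<Union>B\<in>{B \<in> monomials (wt A). B < A}. monomial_image b B)"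
    then obtain B where B: "B \<in> monomials (wt A)" "B < A" "x \<in> monomial_image b B" by blast
    then have wB: "wt B = wt A" by (simp add: monomials_def)
    have xP: "x \<in> P (b + wt A)"
      using submoduleD(2)[OF submodule_monomial_image[OF b] B(3)] wB by simp
    have "add_mset j B \<in> monomials (wt (add_mset j A))"
      using add_monomial[OF B(1) j] by (simp add: wt_simps add.commute)
    moreover have "add_mset j B < add_mset j A"
      using B(2) add_strict_left_mono[of B A "{#j#}"] by simp
    moreover have "mul (b + wt A) j x \<in> monomial_image b (add_mset j B)"
      using monomial_image_add[OF b, of j B] B(3) wB by simp
    ultimately have "mul (b + wt A) j x \<in> lower b (add_mset j A)"
      unfolding lower_def by (intro span_base) blast
    then show "x \<in> {x \<in> P (b + wt A). comp (b + wt A) (ar j) 1 x (gv j) \<in> lower b (add_mset j A)}"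
      using xP by (simp add: mul_def)
  qed
  then have "lower b A \<subseteq> {x \<in> P (b + wt A). comp (b + wt A) (ar j) 1 x (gv j) \<in> lower b (add_mset j A)}"
    unfolding lower_def[of b A]
    by (rule span_minimal) (rule subspace_comp_left_vimage[OF gv b1], simp add: lower_def)
  then show ?thesis by (auto simp: mul_def)
qed

text \<open>If A is not standard, multiplying the inclusion of its image in \<open>lower b A\<close> by a variable shows
  that no multiple of A is standard.\<close>

lemma standard_downward_closed:
  assumes b: "m0 \<le> b"
  shows "A \<in> standard b \<Longrightarrow> B \<subseteq># A \<Longrightarrow> B \<in> standard b"
proof -
  have step: "A \<in> standard b" if "add_mset j A \<in> standard b" for j A
  proof -
    have j: "j < s" "set_mset A \<subseteq> {..<s}" using that unfolding standard_def by auto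
    have "monomial_image b (add_mset j A) \<subseteq> lower b (add_mset j A)" if "monomial_image b A \<subseteq> lower b A"
      unfolding monomial_image_add[OF b] using lower_mul[OF b j(1), of A] that by blast
    then show ?thesis using that j unfolding standard_def by blast
  qed
  have "B \<in> standard b" if "B + C \<in> standard b" for B C
    using that by (induction C) (auto intro: step)
  then show "A \<in> standard b \<Longrightarrow> B \<subseteq># A \<Longrightarrow> B \<in> standard b"
    by (metis subset_mset.le_iff_add)
qed

lemma standard_span:
  "set_mset A \<subseteq> {..<s} \<Longrightarrow>
    monomial_image b A \<subseteq> span (\<Union>B\<in>standard b \<inter> monomials (wt A). monomial_image b B)"
proof (induction A rule: less_induct)
  case (less A)
  show ?case
  proof (cases "A \<in> standard b")
    case True
    then have "monomial_image b A \<subseteq> (\<Union>B\<in>standard b \<inter> monomials (wt A). monomial_image b B)"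
      using less.prems by (auto simp: monomials_def)
    then show ?thesis using span_superset by blast
  next
    case False
    then have "monomial_image b A \<subseteq> lower b A"
      using less.prems by (auto simp: standard_def)
    also have "\<dots> \<subseteq> span (\<Union>B\<in>standard b \<inter> monomials (wt A). monomial_image b B)"
      unfolding lower_def
    proof (rule span_minimal[OF _ subspace_span], rule UN_least)
      fix B assume "B \<in> {B \<in> monomials (wt A). B < A}"
      then show "monomial_image b B \<subseteq> span (\<Union>B\<in>standard b \<inter> monomials (wt A). monomial_image b B)"
        using less.IH[of B] by (simp add: monomials_def)
    qed
    finally show ?thesis .
  qed
qed

text \<open>Choose in the image of each standard monomial a vector not in the span of the smaller images.
  Such vectors are linearly independent.\<close>

lemma card_standard_le_dim:
  assumes b: "m0 \<le> b"
  shows "card (standard b \<inter> monomials n) \<le> dim (P (b + n))"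
proof -
  have "\<forall>A\<in>standard b. \<exists>v. v \<in> monomial_image b A - lower b A"
    unfolding standard_def by blast
  from bchoice[OF this] obtain v where v: "\<And>A. A \<in> standard b \<Longrightarrow> v A \<in> monomial_image b A - lower b A"
    by blast
  have ind: "F \<subseteq> standard b \<inter> monomials n \<Longrightarrow> independent (v ` F) \<and> inj_on v F" if "finite F" for F
    using that
  proof (induction F rule: finite_linorder_max_induct)
    case (insert A F)
    have A: "A \<in> standard b" "A \<in> monomials n" and F: "F \<subseteq> standard b \<inter> monomials n"
      using insert.prems by auto
    have "v ` F \<subseteq> (\<Union>B\<in>{B \<in> monomials (wt A). B < A}. monomial_image b B)"
    proof
      fix x assume "x \<in> v ` F"
      then obtain B where B: "B \<in> F" "x = v B" by blast
      then have "B \<in> monomials (wt A)" "B < A" "x \<in> monomial_image b B"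
        using F A insert.hyps v[of B] by (auto simp: monomials_def)
      then show "x \<in> (\<Union>B\<in>{B \<in> monomials (wt A). B < A}. monomial_image b B)" by blast
    qed
    then have "span (v ` F) \<subseteq> lower b A"
      unfolding lower_def by (rule span_mono)
    then have new: "v A \<notin> span (v ` F)"
      using v[OF A(1)] by blast
    then have "v A \<notin> v ` F" using span_base by blast
    then show ?case
      using independent_insertI[OF new] insert.IH[OF F] by auto
  qed (simp add: independent_empty)
  have F: "finite (standard b \<inter> monomials n)" using finite_monomials by blast
  obtain C where C: "finite C" "span C = P (b + n)"
    using fin_dim unfolding locally_finite_def by blast
  have "v A \<in> P (b + n)" if "A \<in> standard b \<inter> monomials n" for A
    using submoduleD(2)[OF submodule_monomial_image[OF b, of A]] v[of A] that by (auto simp: monomials_def)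
  then have sub: "v ` (standard b \<inter> monomials n) \<subseteq> P (b + n)" by blast
  have "card (standard b \<inter> monomials n) = dim (v ` (standard b \<inter> monomials n))"
    using ind[OF F order.refl] by (simp add: card_image dim_eq_card_independent)
  also have "\<dots> \<le> dim (P (b + n))"
    using C by (intro subspace_dim_mono[OF sub, of C]) auto
  finally show ?thesis .
qed

lemma monomial_image_finite_span:
  assumes b: "m0 \<le> b"
  shows "\<exists>C. finite C \<and> card C \<le> dim (P b) \<and> C \<subseteq> P (b + wt A) \<and> monomial_image b A \<subseteq> span C"
proof (induction A)
  case empty
  obtain D where D: "finite D" "span D = P b"
    using fin_dim unfolding locally_finite_def by blast
  obtain C where C: "C \<subseteq> P b" "independent C" "P b \<subseteq> span C" "card C = dim (P b)"
    using basis_exists[of "P b"] by blast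
  have "finite C"
    using independent_span_bound[OF D(1) C(2)] C(1) D(2) by auto
  then show ?case
    using C by (intro exI[of _ C]) (simp add: monomial_image_empty wt_simps)
next
  case (add j A)
  then obtain C where C: "finite C" "card C \<le> dim (P b)" "C \<subseteq> P (b + wt A)" "monomial_image b A \<subseteq> span C"
    by blast
  have b1: "1 \<in> {1..b + wt A}" using b m0 by auto
  have "mul (b + wt A) j ` C \<subseteq> P (b + wt (add_mset j A))"
    using comp_closed[OF _ gv b1, of _ j] C(3) ar[of j] by (auto simp: mul_def wt_simps add_ac)
  moreover have "span C \<subseteq> {x \<in> P (b + wt A). comp (b + wt A) (ar j) 1 x (gv j) \<in> span (mul (b + wt A) j ` C)}"
    using C(3) by (intro span_minimal subspace_comp_left_vimage[OF gv b1] subspace_span)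
      (auto simp: mul_def intro: span_base)
  then have "monomial_image b (add_mset j A) \<subseteq> span (mul (b + wt A) j ` C)"
    unfolding monomial_image_add[OF b] using C(4) by (auto simp: mul_def)
  ultimately show ?case
    using C(1,2) card_image_le[OF C(1), of "mul (b + wt A) j"]
    by (intro exI[of _ "mul (b + wt A) j ` C"]) auto
qed

text \<open>For each b the standard monomials span what all monomials span, and a monomial does not
  increase the dimension.\<close>

lemma dim_le_card_standard:
  assumes n: "m0 + r \<le> n"
  shows "dim (P n) \<le> (\<Sum>b\<in>{m0..<m0 + r}. card (standard b \<inter> monomials (n - b)) * dim (P b))"
proof -
  define I where "I = {m0..<m0 + r}"
  have I: "m0 \<le> b" "b \<le> n" if "b \<in> I" for b using that n unfolding I_def by auto
  have "\<forall>p\<in>I \<times> UNIV. \<exists>C. finite C \<and> card C \<le> dim (P (fst p)) \<and> monomial_image (fst p) (snd p) \<subseteq> span C"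
    using monomial_image_finite_span[OF I(1)] by (metis mem_Times_iff)
  from bchoice[OF this] obtain C where C: "\<And>b A. b \<in> I \<Longrightarrow>
      finite (C (b, A)) \<and> card (C (b, A)) \<le> dim (P b) \<and> monomial_image b A \<subseteq> span (C (b, A))"
    by auto
  define T where "T = (\<Union>b\<in>I. \<Union>A\<in>standard b \<inter> monomials (n - b). C (b, A))"
  have finT: "finite T"
    unfolding T_def I_def using C finite_monomials by (auto simp: I_def)
  have "P n \<subseteq> span (\<Union>b\<in>I. \<Union>A\<in>{A. b \<le> n \<and> A \<in> monomials (n - b)}. monomial_image b A)"
    unfolding I_def using n by (intro monomials_span) simp
  also have "\<dots> \<subseteq> span T"
  proof (rule span_minimal[OF _ subspace_span], intro UN_least)
    fix b A assume b: "b \<in> I" and A: "A \<in> {A. b \<le> n \<and> A \<in> monomials (n - b)}"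
    have "monomial_image b A \<subseteq> span (\<Union>B\<in>standard b \<inter> monomials (wt A). monomial_image b B)"
      using A by (intro standard_span) (simp add: monomials_def)
    also have "\<dots> \<subseteq> span T"
    proof (rule span_minimal[OF _ subspace_span], rule UN_least)
      fix B assume "B \<in> standard b \<inter> monomials (wt A)"
      then have "C (b, B) \<subseteq> T" unfolding T_def using A b by (auto simp: monomials_def)
      then show "monomial_image b B \<subseteq> span T"
        using C[OF b, of B] span_mono[of "C (b, B)" T] by blast
    qed
    finally show "monomial_image b A \<subseteq> span T" .
  qed
  finally have "dim (P n) \<le> card T"
    using finT by (rule dim_le_card)
  also have "\<dots> \<le> (\<Sum>b\<in>I. card (\<Union>A\<in>standard b \<inter> monomials (n - b). C (b, A)))"
    unfolding T_def I_def by (rule card_UN_le) simp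
  also have "\<dots> \<le> (\<Sum>b\<in>I. card (standard b \<inter> monomials (n - b)) * dim (P b))"
  proof (rule sum_mono)
    fix b assume b: "b \<in> I"
    have "card (\<Union>A\<in>standard b \<inter> monomials (n - b). C (b, A))
        \<le> (\<Sum>A\<in>standard b \<inter> monomials (n - b). card (C (b, A)))"
      using finite_monomials by (intro card_UN_le) auto
    also have "\<dots> \<le> (\<Sum>A\<in>standard b \<inter> monomials (n - b). dim (P b))"
      using C[OF b] by (intro sum_mono) auto
    finally show "card (\<Union>A\<in>standard b \<inter> monomials (n - b). C (b, A))
        \<le> card (standard b \<inter> monomials (n - b)) * dim (P b)" by simp
  qed
  finally show ?thesis unfolding I_def .
qed

text \<open>If for some b all monomials in two variables i and j are standard, then the \<open>(q + 1)\<^sup>2\<close> monomials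
  with both exponents at most q have weight at most \<open>q * (ar i + ar j)\<close>, and they contribute
  linearly independent vectors.\<close>

theorem bounded_or_quadratic:
  "(\<exists>C. \<forall>n. dim (P n) \<le> C) \<or> (\<exists>b e. \<forall>q. (q + 1)\<^sup>2 \<le> (\<Sum>n\<le>b + q * e. dim (P n)))"
proof (cases "\<exists>b\<in>{m0..<m0 + r}. \<exists>i j. i \<noteq> j \<and> (\<forall>a c. replicate_mset a i + replicate_mset c j \<in> standard b)")
  case True
  then obtain b i j where b: "b \<in> {m0..<m0 + r}" and ij: "i \<noteq> j"
      "\<And>a c. replicate_mset a i + replicate_mset c j \<in> standard b" by blast
  define e where "e = ar i + ar j"
  define f where "f p = replicate_mset (fst p) i + replicate_mset (snd p) j" for p
  have inj: "inj f"
  proof (rule injI)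
    fix p p' assume eq: "f p = f p'"
    have "count (f p) i = fst p" "count (f p) j = snd p" for p
      using ij(1) by (auto simp: f_def)
    then show "p = p'" using eq by (metis prod.expand)
  qed
  have wtf: "wt (f p) = fst p * (ar i - 1) + snd p * (ar j - 1)" for p
    by (simp add: f_def wt_def)
  have "(q + 1)\<^sup>2 \<le> (\<Sum>n\<le>b + q * e. dim (P n))" for q
  proof -
    have sub: "f ` ({..q} \<times> {..q}) \<subseteq> (\<Union>n\<le>q * e. standard b \<inter> monomials n)"
    proof
      fix A assume "A \<in> f ` ({..q} \<times> {..q})"
      then obtain p where p: "A = f p" "fst p \<le> q" "snd p \<le> q" by auto
      have "wt A \<le> q * ar i + q * ar j"
        unfolding p(1) wtf using p(2,3) by (intro add_mono mult_mono) auto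
      moreover have "A \<in> standard b" unfolding p(1) f_def by (rule ij(2))
      moreover have "A \<in> monomials (wt A)"
        using calculation(2) by (auto simp: monomials_def standard_def)
      ultimately show "A \<in> (\<Union>n\<le>q * e. standard b \<inter> monomials n)"
        by (auto simp: e_def distrib_left)
    qed
    have "(q + 1)\<^sup>2 = card (f ` ({..q} \<times> {..q}))"
      using card_image[OF inj_on_subset[OF inj subset_UNIV], of "{..q} \<times> {..q}"]
      by (simp add: power2_eq_square)
    also have "\<dots> \<le> card (\<Union>n\<le>q * e. standard b \<inter> monomials n)"
      using finite_monomials by (intro card_mono[OF _ sub]) auto
    also have "\<dots> \<le> (\<Sum>n\<le>q * e. card (standard b \<inter> monomials n))"
      by (rule card_UN_le) simp
    also have "\<dots> \<le> (\<Sum>n\<le>q * e. dim (P (b + n)))"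
      using b by (intro sum_mono card_standard_le_dim) auto
    also have "\<dots> = (\<Sum>n\<in>{b..b + q * e}. dim (P n))"
      by (rule sum.reindex_bij_witness[of _ "\<lambda>n. n - b" "\<lambda>n. b + n"]) auto
    also have "\<dots> \<le> (\<Sum>n\<le>b + q * e. dim (P n))"
      by (rule sum_mono2) auto
    finally show ?thesis .
  qed
  then show ?thesis by blast
next
  case False
  have "\<exists>C. \<forall>n. card (standard b \<inter> monomials n) \<le> C" if b: "b \<in> {m0..<m0 + r}" for b
  proof -
    have "\<exists>C. \<forall>n. card {A \<in> standard b. (\<Sum>j\<in>#A. ar j - 1) = n} \<le> C"
    proof (rule disjE[OF order_ideal_dichotomy[of "\<lambda>j. ar j - 1" "standard b" s]])
      show "1 \<le> ar j - 1" for j using ar[of j] by simp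
      show "set_mset A \<subseteq> {..<s}" if "A \<in> standard b" for A using that by (simp add: standard_def)
      show "B \<in> standard b" if "A \<in> standard b" "B \<subseteq># A" for A B
        using standard_downward_closed[of b A B] b that by simp
    qed (use False b in blast)+
    moreover have "{A \<in> standard b. (\<Sum>j\<in>#A. ar j - 1) = n} = standard b \<inter> monomials n" for n
      unfolding monomials_def standard_def wt_def by auto
    ultimately show ?thesis by simp
  qed
  then have "\<forall>b\<in>{m0..<m0 + r}. \<exists>C. \<forall>n. card (standard b \<inter> monomials n) \<le> C" by blast
  from bchoice[OF this] obtain C where C: "\<And>b n. b \<in> {m0..<m0 + r} \<Longrightarrow> card (standard b \<inter> monomials n) \<le> C b"
    by blast
  define D where "D = (\<Sum>b\<in>{m0..<m0 + r}. C b * dim (P b)) + (\<Sum>n<m0 + r. dim (P n))"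
  have "dim (P n) \<le> D" for n
  proof (cases "n < m0 + r")
    case True
    then show ?thesis
      using member_le_sum[of n "{..<m0 + r}" "\<lambda>n. dim (P n)"] unfolding D_def by simp
  next
    case False
    have "dim (P n) \<le> (\<Sum>b\<in>{m0..<m0 + r}. card (standard b \<inter> monomials (n - b)) * dim (P b))"
      using dim_le_card_standard[of n] False by simp
    also have "\<dots> \<le> (\<Sum>b\<in>{m0..<m0 + r}. C b * dim (P b))"
      by (intro sum_mono mult_right_mono C) auto
    finally show ?thesis unfolding D_def by simp
  qed
  then show ?thesis by blast
qed

end

section \<open>Growth\<close>

lemma limsup_log_less_two:
  fixes F :: "nat \<Rightarrow> nat"
  assumes lim: "limsup (\<lambda>n. ereal (log (real n) (real (F n)))) < 2" and c: "0 < c"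
  shows "eventually (\<lambda>n. real (F n) < c * real n ^ 2) sequentially"
proof -
  obtain y where y: "limsup (\<lambda>n. ereal (log (real n) (real (F n)))) < ereal y" "ereal y < 2"
    using ereal_dense2[OF lim] by blast
  then have y2: "y < 2" by simp
  have "eventually (\<lambda>n. ereal (log (real n) (real (F n))) < ereal y) sequentially"
    using Limsup_lessD[OF y(1)] .
  moreover have "(\<lambda>n. real n powr (y - 2)) \<longlonglongrightarrow> 0"
    using y2 by real_asymp
  then have "eventually (\<lambda>n. real n powr (y - 2) < c) sequentially"
    using c by (rule order_tendstoD)
  moreover have "eventually (\<lambda>n. 2 \<le> n) sequentially"
    by (rule eventually_ge_at_top)
  ultimately show ?thesis
  proof eventually_elim
    case (elim n)
    show ?case
    proof (cases "F n = 0")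
      case True
      then show ?thesis using c elim by simp
    next
      case False
      have "real (F n) = real n powr log (real n) (real (F n))"
        using False elim by (subst powr_log_cancel) auto
      also have "\<dots> \<le> real n powr y"
        using elim by (intro powr_mono) auto
      also have "\<dots> = real n powr (y - 2) * real n powr 2"
        by (simp only: powr_add[symmetric]) simp
      also have "\<dots> < c * real n powr 2"
        using elim by (intro mult_strict_right_mono) auto
      finally show ?thesis using elim by simp
    qed
  qed
qed

lemma limsup_log_le_one:
  fixes F :: "nat \<Rightarrow> nat"
  assumes F: "\<And>n. F n \<le> C * (n + 1)"
  shows "limsup (\<lambda>n. ereal (log (real n) (real (F n)))) \<le> 1"
proof -
  define D where "D = real C + 1"
  have D: "D \<ge> 1" by (simp add: D_def)
  have "(\<lambda>n. log (real n) (D * (real n + 1))) \<longlonglongrightarrow> 1"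
    using D by real_asymp
  then have "(\<lambda>n. ereal (log (real n) (D * (real n + 1)))) \<longlonglongrightarrow> ereal 1"
    by simp
  then have lim: "limsup (\<lambda>n. ereal (log (real n) (D * (real n + 1)))) = 1"
    by (simp add: lim_imp_Limsup one_ereal_def)
  have "eventually (\<lambda>n. ereal (log (real n) (real (F n))) \<le> ereal (log (real n) (D * (real n + 1)))) sequentially"
    using eventually_ge_at_top[of 2]
  proof eventually_elim
    case (elim n)
    have le: "real (F n) \<le> D * (real n + 1)"
    proof -
      have "real (F n) \<le> real (C * (n + 1))" using F[of n] by (simp only: of_nat_le_iff)
      also have "\<dots> \<le> D * (real n + 1)" by (simp add: D_def algebra_simps)
      finally show ?thesis .
    qed
    have ge1: "1 \<le> D * (real n + 1)"
      using D mult_mono[OF D, of 1 "real n + 1"] by simp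
    show ?case
    proof (cases "F n = 0")
      case True
      have "0 \<le> log (real n) (D * (real n + 1))"
        using ge1 elim by (simp add: zero_le_log_cancel_iff)
      then show ?thesis using True by (simp add: log_def)
    next
      case False
      then show ?thesis using le ge1 elim by simp
    qed
  qed
  then have "limsup (\<lambda>n. ereal (log (real n) (real (F n)))) \<le> limsup (\<lambda>n. ereal (log (real n) (D * (real n + 1))))"
    by (rule Limsup_mono)
  then show ?thesis using lim by simp
qed

text \<open>If every window of length L above M contained an n with \<open>a n > (n - 5) / 2\<close>, then the K windows
  that follow a large K would each contribute at least \<open>K / 4\<close> to the sum of the \<open>a i\<close> with
  \<open>i \<le> K + K * L\<close>, which is quadratic growth.\<close>

lemma subquadratic_window:
  fixes a :: "nat \<Rightarrow> nat"
  assumes sub: "\<And>c. 0 < c \<Longrightarrow> eventually (\<lambda>n. real (\<Sum>i\<le>n. a i) < c * real n ^ 2) sequentially"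
  shows "\<exists>m\<ge>M. \<forall>n. m \<le> n \<and> n < m + L \<longrightarrow> 2 * a n + 5 \<le> n"
proof (rule ccontr)
  assume no: "\<not> ?thesis"
  have "0 < (1::real) / (8 * (real L + 1)\<^sup>2)" by simp
  from sub[OF this] obtain N0 where N0: "\<forall>n\<ge>N0.
      real (\<Sum>i\<le>n. a i) < 1 / (8 * (real L + 1)\<^sup>2) * real n ^ 2"
    unfolding eventually_sequentially by (rule exE)
  define K where "K = M + N0 + 8"
  have big: "\<exists>n. m \<le> n \<and> n < m + L \<and> K \<le> 4 * a n" if m: "K \<le> m" for m
  proof -
    have "M \<le> m" using m by (simp add: K_def)
    then have "\<not> (\<forall>n. m \<le> n \<and> n < m + L \<longrightarrow> 2 * a n + 5 \<le> n)" using no by blast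
    then obtain n where n: "m \<le> n" "n < m + L" "n < 2 * a n + 5"
      by (auto simp: not_le)
    then show ?thesis using m unfolding K_def by (intro exI[of _ n]) linarith
  qed
  have "t * K \<le> 4 * (\<Sum>i<K + t * L. a i)" for t
  proof (induction t)
    case (Suc t)
    obtain n where n: "K + t * L \<le> n" "n < K + t * L + L" "K \<le> 4 * a n"
      using big[of "K + t * L"] by auto
    have "(\<Sum>i<K + t * L. a i) + a n = (\<Sum>i\<in>insert n {..<K + t * L}. a i)"
      using n(1) by simp
    also have "\<dots> \<le> (\<Sum>i<K + Suc t * L. a i)"
      using n(2) by (intro sum_mono2) auto
    finally show ?case using Suc n(3) by simp
  qed simp
  then have "K * K \<le> 4 * (\<Sum>i<K + K * L. a i)" .
  also have "(\<Sum>i<K + K * L. a i) \<le> (\<Sum>i\<le>K + K * L. a i)"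
    by (rule sum_mono2) auto
  finally have "real (K * K) \<le> real (4 * (\<Sum>i\<le>K + K * L. a i))"
    by (simp only: of_nat_le_iff mult_le_mono2)
  then have "real K * real K \<le> 4 * real (\<Sum>i\<le>K + K * L. a i)"
    by simp
  also have "\<dots> < 4 * (1 / (8 * (real L + 1)\<^sup>2) * real (K + K * L) ^ 2)"
    using spec[OF N0, of "K + K * L"] unfolding K_def by simp
  also have "real (K + K * L) = real K * (real L + 1)"
    by (simp add: algebra_simps)
  also have "4 * (1 / (8 * (real L + 1)\<^sup>2) * (real K * (real L + 1)) ^ 2) = real K * real K / 2"
  proof -
    have "4 * (1 / (8 * u\<^sup>2) * (k * u)\<^sup>2) = k * k / 2" if "u \<noteq> 0" for u k :: real
      using that by (simp add: power2_eq_square)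
    then show ?thesis by simp
  qed
  finally have "real K * real K < real K * real K / 2" .
  then show False by (simp add: not_less mult_nonneg_nonneg)
qed

lemma subquadratic_not_quadratic:
  fixes F :: "nat \<Rightarrow> nat"
  assumes sub: "\<And>c. 0 < c \<Longrightarrow> eventually (\<lambda>n. real (F n) < c * real n ^ 2) sequentially"
  shows "\<exists>q. F (b + q * e) < (q + 1)\<^sup>2"
proof (rule ccontr)
  assume "\<not> ?thesis"
  then have ge: "(q + 1)\<^sup>2 \<le> F (b + q * e)" for q by (auto simp: not_less)
  define d where "d = b + e + 1"
  have d: "0 < d" by (simp add: d_def)
  have "0 < 1 / (real d)\<^sup>2" using d by simp
  from sub[OF this] obtain N0 where N0: "\<forall>n\<ge>N0. real (F n) < 1 / (real d)\<^sup>2 * real n ^ 2"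
    unfolding eventually_sequentially by (rule exE)
  show False
  proof (cases "e = 0")
    case True
    have "(F b + 1)\<^sup>2 \<le> F b" using ge[of "F b"] True by simp
    then show False by (simp add: power2_eq_square)
  next
    case False
    define n where "n = b + N0 * e"
    have "N0 \<le> n" unfolding n_def using False by (cases e) auto
    have "real n \<le> real d * real (N0 + 1)"
      unfolding n_def d_def by (simp add: algebra_simps)
    then have "(real n)\<^sup>2 \<le> (real d * real (N0 + 1))\<^sup>2"
      by (intro power_mono) auto
    then have "1 / (real d)\<^sup>2 * real n ^ 2 \<le> 1 / (real d)\<^sup>2 * (real d * real (N0 + 1))\<^sup>2"
      by (intro mult_left_mono) auto
    also have "\<dots> = real ((N0 + 1)\<^sup>2)"
      using d by (simp add: power_mult_distrib)
    also have "\<dots> \<le> real (F n)"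
      using ge[of N0] unfolding n_def by (simp only: of_nat_le_iff)
    finally show False using N0 \<open>N0 \<le> n\<close> by (simp add: not_less[symmetric])
  qed
qed

context symmetric_operad
begin

text \<open>Subquadratic growth provides a window of r arities of small dimension, hence of tame ones, from
  which tameness spreads to all later arities. The monomial module structure then leaves only
  bounded dimensions.\<close>

theorem bounded_dim_if_subquadratic:
  assumes red: reduced and lf: locally_finite and fg: finitely_generated
    and sub: "\<And>c. 0 < c \<Longrightarrow> eventually (\<lambda>n. real (\<Sum>i\<le>n. dim (P i)) < c * real n ^ 2) sequentially"
  shows "\<exists>C. \<forall>n. dim (P n) \<le> C"
proof -
  obtain G where G: "finite G" "\<And>n. P n = {x. generated G n x}"
    using fg unfolding finitely_generated_def by blast
  define r where "r = 2 + (\<Sum>p\<in>G. fst p)"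
  have r: "n \<le> r" if "(n, x) \<in> G" for n x
    using member_le_sum[OF that, of fst] G(1) by (auto simp: r_def)
  have r2: "2 \<le> r" by (simp add: r_def)
  have leaf: "leaf_sum r n x" if "r < n" "x \<in> P n" for n x
    using generated_leaf_sum[OF red G(2), of r n x] r r2 that G(2)[of n] by auto
  obtain m where m: "2 * r + 2 \<le> m" "\<And>n. m \<le> n \<Longrightarrow> n < m + r \<Longrightarrow> 2 * dim (P n) + 5 \<le> n"
    using subquadratic_window[OF sub, of "2 * r + 2" r] by blast
  have tame: "tame n" if "m \<le> n" for n
    using tame_propagates[OF r2 leaf m(1) _ that] tame_if_small_dim[OF lf m(2)] by simp
  obtain B where B: "\<And>k. finite (B k) \<and> span (B k) = P k"
    using lf unfolding locally_finite_def by metis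
  \<comment> \<open>The zero operation of arity 2 is added as a value for the indices beyond the list of variables.\<close>
  define I where "I = insert (2, 0) (Sigma {2..r} B)"
  have "finite I" unfolding I_def using B by blast
  then obtain ps where ps: "set ps = I" using finite_list by blast
  define s where "s = length ps"
  define el where "el j = (if j < s then ps ! j else (2, 0))" for j
  have el: "el j \<in> I" for j
    unfolding el_def s_def using ps nth_mem[of j ps] by (auto simp: I_def)
  have ar: "2 \<le> fst (el j)" "snd (el j) \<in> P (fst (el j))" for j
  proof -
    show "2 \<le> fst (el j)" using el[of j] unfolding I_def by auto
    have "snd p \<in> P (fst p)" if "p \<in> I" for p
      using that B span_base subspace_0[OF subspace_P] unfolding I_def by fastforce
    then show "snd (el j) \<in> P (fst (el j))" using el by blast
  qed
  have mon: "monomial_operad scale P act one comp m (\<lambda>j. fst (el j)) (\<lambda>j. snd (el j)) s r"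
  proof unfold_locales
    fix k assume k: "2 \<le> k" "k \<le> r"
    have "B k \<subseteq> {snd (el j) |j. j < s \<and> fst (el j) = k}"
    proof
      fix g assume "g \<in> B k"
      then have "(k, g) \<in> set ps" unfolding ps I_def using k by auto
      then obtain j where "j < s" "ps ! j = (k, g)"
        unfolding s_def by (auto simp: in_set_conv_nth)
      then show "g \<in> {snd (el j) |j. j < s \<and> fst (el j) = k}"
        by (auto simp: el_def intro!: exI[of _ j])
    qed
    then show "P k \<subseteq> span {snd (el j) |j. j < s \<and> fst (el j) = k}"
      using B[of k] span_mono by blast
  qed (use tame ar lf leaf m r2 in auto)
  obtain C where "\<forall>n. dim (P n) \<le> C"
    using monomial_operad.bounded_or_quadratic[OF mon] subquadratic_not_quadratic[OF sub]
    by (meson not_less)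
  then show ?thesis by blast
qed

theorem GKdim_gap:
  assumes red: reduced and lf: locally_finite and fg: finitely_generated and lt: "GKdim < 2"
  shows "GKdim \<le> 1"
proof -
  have "eventually (\<lambda>n. real (\<Sum>i\<le>n. dim (P i)) < c * real n ^ 2) sequentially" if "0 < c" for c
    using limsup_log_less_two[OF lt[unfolded GKdim_def] that] .
  then obtain C where C: "dim (P n) \<le> C" for n
    using bounded_dim_if_subquadratic[OF red lf fg] by blast
  have "(\<Sum>i\<le>n. dim (P i)) \<le> C * (n + 1)" for n
    using sum_bounded_above[of "{..n}" "\<lambda>i. dim (P i)" C] C by (simp add: mult.commute)
  then show ?thesis
    unfolding GKdim_def by (rule limsup_log_le_one)
qed

end

theorem theorem0p1:
  fixes scale :: "'k::field \<Rightarrow> 'v::ab_group_add \<Rightarrow> 'v"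
    and P :: "nat \<Rightarrow> 'v set"
    and act :: "nat \<Rightarrow> 'v \<Rightarrow> (nat \<Rightarrow> nat) \<Rightarrow> 'v"
    and one :: 'v
    and comp :: "nat \<Rightarrow> nat \<Rightarrow> nat \<Rightarrow> 'v \<Rightarrow> 'v \<Rightarrow> 'v"
  assumes "symmetric_operad scale P act one comp"
    and "symmetric_operad.reduced P"
    and "symmetric_operad.locally_finite scale P"
    and "symmetric_operad.finitely_generated scale P act one comp"
  shows "\<not> (1 < symmetric_operad.GKdim scale P \<and> symmetric_operad.GKdim scale P < 2)"
  using symmetric_operad.GKdim_gap[OF assms] by (auto simp: not_less)

end
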